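(* Let $p>1$ and $h\in C[0,\infty)$ with $h(s)>0$ for $s>0$. Assume that $h$ is bounded on $[0,\infty)$, that \[ \lim_{t\to\infty} t^{-(p+1)/2}\int_0^t s^{p+1}h(s)\,ds=\infty, \] and that the equation $w''+h(s)|w|^{p-1}w=0$ has a solution $w_0$ on $[0,\infty)$ with $w_0(0)=0$ and $w_0(s)>0$ for $s>0$. Then for all sufficiently large $c>0$ the problem \[ w''+h(s)|w|^{p-1}w=0\ (0<s<c),\quad w(0)=w(c)=0,\quad w(s)>0\ (0<s<c), \] has at least three solutions. *)

theory Defs
  imports "HOL-Analysis.Analysis"
begin

definition ode_sol_on :: "(real \<Rightarrow> real) \<Rightarrow> real \<Rightarrow> real set \<Rightarrow> (real \<Rightarrow> real) \<Rightarrow> bool" where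
  "ode_sol_on h p S w \<longleftrightarrow>
     (\<exists>w' w''. \<forall>s\<in>S. (w has_real_derivative w' s) (at s)
                    \<and> (w' has_real_derivative w'' s) (at s)
                    \<and> w'' s + h s * (\<bar>w s\<bar> powr (p - 1)) * w s = 0)"

definition dirichlet_pos_sol :: "(real \<Rightarrow> real) \<Rightarrow> real \<Rightarrow> real \<Rightarrow> (real \<Rightarrow> real) \<Rightarrow> bool" where
  "dirichlet_pos_sol h p c w \<longleftrightarrow>
     continuous_on {0..c} w \<and> ode_sol_on h p {0<..<c} w
     \<and> w 0 = 0 \<and> w c = 0 \<and> (\<forall>s\<in>{0<..<c}. w s > 0)"

definition differ_on :: "real set \<Rightarrow> (real \<Rightarrow> real) \<Rightarrow> (real \<Rightarrow> real) \<Rightarrow> bool" where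
  "differ_on A u v \<longleftrightarrow> (\<exists>s\<in>A. u s \<noteq> v s)"

end

theory Submission
  imports Defs "HOL-Complex_Analysis.Great_Picard"
begin

text \<open>Replacing \<open>|w|\<^sup>p\<^sup>-\<^sup>1 w\<close> by the power of the positive part makes every solution with \<open>w(0) = 0\<close>,
  \<open>w'(0) = a > 0\<close> concave and below \<open>a s\<close>, hence global, unique and continuous in \<open>a\<close>; and
  \<open>w(c; a) = 0\<close> alone already makes it a solution of the boundary value problem. So it suffices
  that \<open>a \<mapsto> w(c; a)\<close> changes sign three times. It is positive for small \<open>a\<close>, positive at the slope
  \<open>a\<^sub>0\<close> of \<open>w\<^sub>0\<close> and negative for large \<open>a\<close>, so one needs a slope \<open>a\<^sub>1 < a\<^sub>0\<close> whose solution has a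
  positive zero \<open>c\<^sub>1\<close>, since it is then negative at every \<open>c > c\<^sub>1\<close>. Such a slope comes from the
  maximiser of \<open>\<integral> h w\<^sub>+\<^sup>p\<^sup>+\<^sup>1\<close> subject to \<open>\<integral> w'\<^sup>2 = 1\<close>: testing with a multiple of \<open>s (c - s)\<close>, the
  growth hypothesis makes the maximum tend to infinity with the interval length, which forces the
  rescaled maximiser, a solution, to have arbitrarily small initial slope.\<close>

section \<open>Iterated primitives\<close>

text \<open>Initial value problems are written as integral equations in
  \<open>prim (prim f)\<close>, which ask only for continuity of the unknown function.\<close>

definition prim :: "(real \<Rightarrow> real) \<Rightarrow> real \<Rightarrow> real" where
  "prim f s = integral {0..s} f"

lemma continuous_bounded_on_Icc:
  fixes f :: "real \<Rightarrow> real"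
  assumes "continuous_on {a..b} f"
  shows "\<exists>B. \<forall>t. a \<le> t \<longrightarrow> t \<le> b \<longrightarrow> \<bar>f t\<bar> \<le> B"
proof -
  have "bounded (f ` {a..b})"
    using assms by (intro compact_imp_bounded compact_continuous_image) auto
  then obtain B where "\<forall>x\<in>f ` {a..b}. norm x \<le> B"
    unfolding bounded_iff by blast
  then show ?thesis by (intro exI[of _ B]) simp
qed

lemma prim_0 [simp]: "prim f 0 = 0"
  by (simp add: prim_def)

lemma prim_deriv_within:
  assumes "continuous_on {0..c} f" "s \<in> {0..c}"
  shows "(prim f has_real_derivative f s) (at s within {0..c})"
  unfolding prim_def using integral_has_real_derivative[OF assms] by (simp add: prim_def)

lemma prim_deriv:
  assumes "continuous_on {0..c} f" "0 < s" "s < c"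
  shows "(prim f has_real_derivative f s) (at s)"
  using prim_deriv_within[OF assms(1), of s] assms(2,3) by (simp add: at_within_Icc_at)

lemma prim_cont:
  assumes "continuous_on {0..c} f"
  shows "continuous_on {0..c} (prim f)"
  using prim_deriv_within[OF assms] by (meson DERIV_continuous_on)

lemma prim_mono:
  assumes "continuous_on {0..c} f" "continuous_on {0..c} g" "s \<le> c"
    and "\<And>t. 0 \<le> t \<Longrightarrow> t \<le> s \<Longrightarrow> f t \<le> g t"
  shows "prim f s \<le> prim g s"
proof -
  have "continuous_on {0..s} f" "continuous_on {0..s} g"
    using assms by (auto intro: continuous_on_subset)
  then show ?thesis
    unfolding prim_def using assms(4)
    by (intro integral_le integrable_continuous_interval) auto
qed

lemma prim_cong:
  assumes "\<And>t. 0 \<le> t \<Longrightarrow> t \<le> s \<Longrightarrow> f t = g t"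
  shows "prim f s = prim g s"
  unfolding prim_def using assms by (intro integral_cong) auto

lemma prim2_cong:
  assumes "\<And>t. 0 \<le> t \<Longrightarrow> t \<le> s \<Longrightarrow> f t = g t"
  shows "prim (prim f) s = prim (prim g) s"
  using assms by (intro prim_cong) auto

lemma prim_diff:
  assumes "continuous_on {0..c} f" "continuous_on {0..c} g" "s \<le> c"
  shows "prim (\<lambda>t. f t - g t) s = prim f s - prim g s"
proof -
  have "continuous_on {0..s} f" "continuous_on {0..s} g"
    using assms by (auto intro: continuous_on_subset)
  then show ?thesis
    unfolding prim_def by (intro integral_diff integrable_continuous_interval)
qed

lemma prim_add:
  assumes "continuous_on {0..c} f" "continuous_on {0..c} g" "s \<le> c"
  shows "prim (\<lambda>t. f t + g t) s = prim f s + prim g s"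
proof -
  have "continuous_on {0..s} f" "continuous_on {0..s} g"
    using assms by (auto intro: continuous_on_subset)
  then show ?thesis
    unfolding prim_def by (intro integral_add integrable_continuous_interval)
qed

lemma prim_mult_left: "prim (\<lambda>t. k * f t) s = k * prim f s"
  unfolding prim_def by simp

lemma prim_mult_left_fun: "prim (\<lambda>t. k * f t) = (\<lambda>s. k * prim f s)"
  by (rule ext) (rule prim_mult_left)

lemma prim_const: "0 \<le> s \<Longrightarrow> prim (\<lambda>_. k) s = k * s"
  unfolding prim_def by simp

lemma prim_nonneg:
  assumes "continuous_on {0..c} f" "s \<le> c" "\<And>t. 0 \<le> t \<Longrightarrow> t \<le> s \<Longrightarrow> 0 \<le> f t"
  shows "0 \<le> prim f s"
  unfolding prim_def using assms
  by (intro integral_nonneg integrable_continuous_interval) (auto intro: continuous_on_subset)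

lemma prim_unique:
  assumes "\<And>t. t \<in> {0..c} \<Longrightarrow> (g has_real_derivative f t) (at t within {0..c})" "g 0 = 0"
    and "0 \<le> s" "s \<le> c"
  shows "prim f s = g s"
proof -
  have "(g has_real_derivative f t) (at t within {0..s})" if "t \<in> {0..s}" for t
    using assms(1)[of t] that assms(4) by (auto intro: has_field_derivative_subset)
  then have "(f has_integral (g s - g 0)) {0..s}"
    using assms(3) by (intro fundamental_theorem_of_calculus)
      (auto simp: has_real_derivative_iff_has_vector_derivative)
  then show ?thesis using assms(2) by (simp add: prim_def integral_unique)
qed

lemma prim_abs_le:
  assumes "continuous_on {0..c} f" "continuous_on {0..c} g" "s \<le> c"
    and "\<And>t. 0 \<le> t \<Longrightarrow> t \<le> s \<Longrightarrow> \<bar>f t\<bar> \<le> g t"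
  shows "\<bar>prim f s\<bar> \<le> prim g s"
proof -
  have "prim f s \<le> prim g s"
    using assms by (intro prim_mono[of c]) (auto dest!: assms(4))
  moreover have "prim (\<lambda>t. (-1) * f t) s \<le> prim g s"
    using assms by (intro prim_mono[of c]) (auto intro!: continuous_intros dest!: assms(4))
  ultimately show ?thesis unfolding prim_mult_left by auto
qed

lemma prim_diff_bounds:
  assumes f: "continuous_on {0..c} f" and xy: "0 \<le> x" "x \<le> y" "y \<le> c"
    and b: "\<And>t. x \<le> t \<Longrightarrow> t \<le> y \<Longrightarrow> l \<le> f t \<and> f t \<le> u"
  shows "(y - x) * l \<le> prim f y - prim f x" "prim f y - prim f x \<le> (y - x) * u"
proof -
  have "(y - x) * l \<le> prim f y - prim f x \<and> prim f y - prim f x \<le> (y - x) * u"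
  proof (cases "x = y")
    case False
    then have "x < y" using xy by simp
    moreover have "continuous_on {x..y} (prim f)"
      using prim_cont[OF f] by (rule continuous_on_subset) (use xy in auto)
    moreover have "(prim f has_derivative (\<lambda>h. f t * h)) (at t)" if "x < t" "t < y" for t
      using prim_deriv[OF f, of t] that xy by (simp add: has_field_derivative_def)
    ultimately obtain z where z: "x < z" "z < y" "prim f y - prim f x = f z * (y - x)"
      using mvt[of x y "prim f" "\<lambda>t h. f t * h"] by blast
    have "l * (y - x) \<le> f z * (y - x)" "f z * (y - x) \<le> u * (y - x)"
      using b[of z] z by (auto intro!: mult_right_mono)
    then show ?thesis using z(3) by (simp add: mult.commute)
  qed simp
  then show "(y - x) * l \<le> prim f y - prim f x" "prim f y - prim f x \<le> (y - x) * u" by auto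
qed

lemma prim_incr:
  assumes f: "continuous_on {0..c} f" and xy: "0 \<le> x" "x \<le> y" "y \<le> c"
    and "\<And>t. 0 \<le> t \<Longrightarrow> t \<le> c \<Longrightarrow> 0 \<le> f t"
  shows "prim f x \<le> prim f y"
proof -
  obtain B where "\<And>t. 0 \<le> t \<Longrightarrow> t \<le> c \<Longrightarrow> \<bar>f t\<bar> \<le> B"
    using continuous_bounded_on_Icc[OF f] by blast
  then have "\<And>t. x \<le> t \<Longrightarrow> t \<le> y \<Longrightarrow> 0 \<le> f t \<and> f t \<le> B"
    using assms by (fastforce dest: abs_le_D1)
  from prim_diff_bounds(1)[OF f xy this] show ?thesis by simp
qed

text \<open>\<open>prim f\<close> is nondecreasing, so \<open>prim (prim f)\<close> is convex, and a
  chord slope lies between the slopes at its ends. The concavity of solutions rests on this.\<close>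

lemma prim2_diff_bounds:
  assumes f: "continuous_on {0..c} f" and xy: "0 \<le> x" "x \<le> y" "y \<le> c"
    and nn: "\<And>t. 0 \<le> t \<Longrightarrow> t \<le> c \<Longrightarrow> 0 \<le> f t"
  shows "(y - x) * prim f x \<le> prim (prim f) y - prim (prim f) x"
    "prim (prim f) y - prim (prim f) x \<le> (y - x) * prim f y"
proof -
  have "prim f x \<le> prim f t \<and> prim f t \<le> prim f y" if "x \<le> t" "t \<le> y" for t
    using prim_incr[OF f, of x t] prim_incr[OF f, of t y] that xy nn by auto
  from prim_diff_bounds[OF prim_cont[OF f] xy this]
  show "(y - x) * prim f x \<le> prim (prim f) y - prim (prim f) x"
    "prim (prim f) y - prim (prim f) x \<le> (y - x) * prim f y" by auto
qed

lemma prim2_le: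
  assumes f: "continuous_on {0..c} f" and s: "0 \<le> s" "s \<le> c"
    and b: "\<And>t. 0 \<le> t \<Longrightarrow> t \<le> s \<Longrightarrow> \<bar>f t\<bar> \<le> B"
  shows "\<bar>prim (prim f) s\<bar> \<le> B * s\<^sup>2"
proof -
  have fs: "continuous_on {0..s} f" using f s by (auto intro: continuous_on_subset)
  have "0 \<le> B" using b[of 0] s by auto
  have "\<bar>prim f t\<bar> \<le> B * s" if "0 \<le> t" "t \<le> s" for t
  proof -
    have "\<bar>prim f t\<bar> \<le> prim (\<lambda>_. B) t"
      using that b by (intro prim_abs_le[OF fs]) auto
    also have "\<dots> \<le> B * s" using that \<open>0 \<le> B\<close> by (simp add: prim_const mult_left_mono)
    finally show ?thesis .
  qed
  then have "\<bar>prim (prim f) s\<bar> \<le> prim (\<lambda>_. B * s) s"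
    by (intro prim_abs_le[OF prim_cont[OF fs]]) auto
  then show ?thesis using s by (simp add: prim_const power2_eq_square)
qed

lemma prim2_diff:
  assumes "continuous_on {0..c} f" "continuous_on {0..c} g" "0 \<le> s" "s \<le> c"
  shows "prim (prim (\<lambda>t. f t - g t)) s = prim (prim f) s - prim (prim g) s"
proof -
  have "prim (prim (\<lambda>t. f t - g t)) s = prim (\<lambda>t. prim f t - prim g t) s"
    using prim_diff[OF assms(1,2)] assms(4) by (intro prim_cong) auto
  also have "\<dots> = prim (prim f) s - prim (prim g) s"
    by (rule prim_diff[OF prim_cont prim_cont]) (use assms in auto)
  finally show ?thesis .
qed

section \<open>Powers of the positive part\<close>

definition pospow :: "real \<Rightarrow> real \<Rightarrow> real" where
  "pospow p x = max 0 x powr p"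

lemma pospow_nonneg [simp]: "0 \<le> pospow p x"
  by (simp add: pospow_def)

lemma pospow_mono: "0 \<le> p \<Longrightarrow> x \<le> y \<Longrightarrow> pospow p x \<le> pospow p y"
  unfolding pospow_def by (intro powr_mono2) auto

lemma pospow_deriv:
  assumes "p > 1"
  shows "(pospow p has_real_derivative p * pospow (p - 1) x) (at x)"
proof -
  consider "x < 0" | "x = 0" | "x > 0" by linarith
  then show ?thesis
  proof cases
    case 1
    have "((\<lambda>_. 0) has_real_derivative 0) (at x)" by simp
    then have "(pospow p has_real_derivative 0) (at x)"
      by (rule has_field_derivative_transform_within_open[of _ _ _ "{..<0}"])
        (use 1 assms in \<open>auto simp: pospow_def\<close>)
    then show ?thesis using 1 assms by (simp add: pospow_def)
  next
    case 3
    have "((\<lambda>x. x powr p) has_real_derivative p * x powr (p - 1)) (at x)"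
      using 3 by (auto intro!: derivative_eq_intros has_real_derivative_powr)
    then have "(pospow p has_real_derivative p * x powr (p - 1)) (at x)"
      by (rule has_field_derivative_transform_within_open[of _ _ _ "{0<..}"])
        (use 3 in \<open>auto simp: pospow_def\<close>)
    then show ?thesis using 3 by (simp add: pospow_def)
  next
    case 2
    \<comment> \<open>At the origin the difference quotient is dominated by
      \<open>|y|^(p-1)\<close>, which tends to 0 because \<open>p > 1\<close>.\<close>
    have "((\<lambda>y::real. \<bar>y\<bar> powr (p - 1)) \<longlongrightarrow> 0) (at 0)"
      using assms by (auto intro!: tendsto_eq_intros)
    then have "((\<lambda>y. pospow p y / y) \<longlongrightarrow> 0) (at 0)"
    proof (rule Lim_null_comparison[rotated])
      show "\<forall>\<^sub>F y in at 0. norm (pospow p y / y) \<le> \<bar>y\<bar> powr (p - 1)"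
        unfolding eventually_at_topological using assms
        by (intro exI[of _ UNIV]) (auto simp: pospow_def powr_diff max_def divide_le_0_iff)
    qed
    then show ?thesis using 2 assms by (simp add: has_field_derivative_iff pospow_def)
  qed
qed

lemma pospow_cont: "p > 1 \<Longrightarrow> continuous_on S (pospow p)"
  using pospow_deriv by (meson DERIV_isCont continuous_at_imp_continuous_on)

lemma pospow_comp_cont: "p > 1 \<Longrightarrow> continuous_on S f \<Longrightarrow> continuous_on S (\<lambda>t. pospow p (f t))"
  using continuous_on_compose2[OF pospow_cont[of p UNIV]] by auto

text \<open>Mean value theorem. Upper bounds on the arguments suffice, because the derivative
  \<open>p * pospow (p - 1)\<close> is nonnegative and nondecreasing.\<close>

lemma pospow_lipschitz:
  assumes "p > 1" "x \<le> R" "y \<le> R" "0 \<le> R"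
  shows "\<bar>pospow p x - pospow p y\<bar> \<le> p * R powr (p - 1) * \<bar>x - y\<bar>"
proof -
  have *: "\<bar>pospow p x - pospow p y\<bar> \<le> p * R powr (p - 1) * \<bar>x - y\<bar>"
    if "y < x" "x \<le> R" for x y
  proof -
    obtain z where z: "y < z" "z < x" "pospow p x - pospow p y = (x - y) * (p * pospow (p - 1) z)"
      using MVT2[OF \<open>y < x\<close>, of "pospow p" "\<lambda>z. p * pospow (p - 1) z"] pospow_deriv[OF assms(1)]
      by blast
    have "pospow (p - 1) z \<le> pospow (p - 1) R" using z that assms by (intro pospow_mono) auto
    then have "pospow (p - 1) z \<le> R powr (p - 1)" using assms by (simp add: pospow_def)
    then have "p * pospow (p - 1) z * (x - y) \<le> p * R powr (p - 1) * (x - y)"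
      using that assms by (intro mult_right_mono mult_left_mono) auto
    then show ?thesis using z(3) that assms by (simp add: abs_mult mult.commute)
  qed
  show ?thesis using *[of x y] *[of y x] assms by (cases x y rule: linorder_cases) (auto simp: abs_minus_commute)
qed

text \<open>A convex function lies above its tangents; the derivative of
  \<open>pospow (p + 1)\<close> is the nondecreasing function
  \<open>(p + 1) * pospow p\<close>.\<close>

lemma pospow_tangent:
  assumes "p > 1"
  shows "pospow (p + 1) y + (p + 1) * pospow p y * (x - y) \<le> pospow (p + 1) x"
proof -
  have d: "(pospow (p + 1) has_real_derivative (p + 1) * pospow p z) (at z)" for z
    using pospow_deriv[of "p + 1" z] assms by simp
  consider "x < y" | "x = y" | "y < x" by linarith
  then show ?thesis
  proof cases
    case 1
    obtain z where z: "x < z" "z < y" "pospow (p+1) y - pospow (p+1) x = (y - x) * ((p+1) * pospow p z)"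
      using MVT2[OF 1, of "pospow (p+1)" "\<lambda>z. (p+1) * pospow p z"] d by blast
    have "(y - x) * ((p+1) * pospow p z) \<le> (y - x) * ((p+1) * pospow p y)"
      using z 1 assms by (intro mult_left_mono pospow_mono) auto
    with z(3) show ?thesis by (simp add: algebra_simps)
  next
    case 3
    obtain z where z: "y < z" "z < x" "pospow (p+1) x - pospow (p+1) y = (x - y) * ((p+1) * pospow p z)"
      using MVT2[OF 3, of "pospow (p+1)" "\<lambda>z. (p+1) * pospow p z"] d by blast
    have "(x - y) * ((p+1) * pospow p y) \<le> (x - y) * ((p+1) * pospow p z)"
      using z 3 assms by (intro mult_left_mono pospow_mono) auto
    with z(3) show ?thesis by (simp add: algebra_simps)
  qed simp
qed

lemma pospow_mult: "p > 0 \<Longrightarrow> pospow p x * x = pospow (p + 1) x"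
  by (cases "x > 0") (auto simp: pospow_def powr_add max_def)

lemma pospow_scale: "k \<ge> 0 \<Longrightarrow> pospow p (k * x) = k powr p * pospow p x"
  by (cases "x \<ge> 0") (auto simp: pospow_def powr_mult max_def zero_le_mult_iff not_le
      mult_le_0_iff mult_nonneg_nonpos)

section \<open>A second-order Volterra equation\<close>

text \<open>Each integration against the weight \<open>exp (l * t)\<close> gains a factor
  \<open>1 / l\<close>, so a large \<open>l\<close> beats any Lipschitz constant (Bielecki
  norm).\<close>

lemma prim_exp_le:
  assumes f: "continuous_on {0..c} f" and s: "0 \<le> s" "s \<le> c" and l: "l > 0" and B: "0 \<le> B"
    and b: "\<And>t. 0 \<le> t \<Longrightarrow> t \<le> s \<Longrightarrow> \<bar>f t\<bar> \<le> B * exp (l * t)"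
  shows "\<bar>prim f s\<bar> \<le> B / l * exp (l * s)"
proof -
  have "\<bar>prim f s\<bar> \<le> prim (\<lambda>t. B * exp (l * t)) s"
    using assms by (intro prim_abs_le[OF f]) (auto intro!: continuous_intros)
  also have "\<dots> = B / l * exp (l * s) - B / l"
    using l s by (subst prim_unique[where c = s and g = "\<lambda>t. B / l * exp (l * t) - B / l"])
      (auto intro!: derivative_eq_intros)
  finally show ?thesis using B l divide_nonneg_pos[OF B l] by linarith
qed

lemma prim2_exp_le:
  assumes f: "continuous_on {0..c} f" and s: "0 \<le> s" "s \<le> c" and l: "l > 0" and B: "0 \<le> B"
    and b: "\<And>t. 0 \<le> t \<Longrightarrow> t \<le> s \<Longrightarrow> \<bar>f t\<bar> \<le> B * exp (l * t)"
  shows "\<bar>prim (prim f) s\<bar> \<le> B / l\<^sup>2 * exp (l * s)"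
proof -
  have "\<bar>prim f t\<bar> \<le> B / l * exp (l * t)" if "0 \<le> t" "t \<le> s" for t
    using that assms by (intro prim_exp_le[OF f]) auto
  then have "\<bar>prim (prim f) s\<bar> \<le> B / l / l * exp (l * s)"
    using s l B by (intro prim_exp_le[OF prim_cont[OF f]]) auto
  then show ?thesis by (simp add: power2_eq_square)
qed

text \<open>Integral form of the initial value problem w'' = -F(s, w), w(0) = 0, w'(0) = a.\<close>

definition volterra :: "(real \<Rightarrow> real \<Rightarrow> real) \<Rightarrow> real \<Rightarrow> real \<Rightarrow> (real \<Rightarrow> real) \<Rightarrow> bool" where
  "volterra F c a w \<longleftrightarrow> continuous_on {0..c} w \<and>
     (\<forall>s\<in>{0..c}. w s = a * s - prim (prim (\<lambda>t. F t (w t))) s)"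

locale volterra_rhs =
  fixes F :: "real \<Rightarrow> real \<Rightarrow> real" and c L :: real
  assumes c: "0 \<le> c" and L: "0 \<le> L"
    and F_cont: "\<And>y. continuous_on {0..c} y \<Longrightarrow> continuous_on {0..c} (\<lambda>t. F t (y t))"
    and F_lip: "\<And>t x y. 0 \<le> t \<Longrightarrow> t \<le> c \<Longrightarrow> \<bar>F t x - F t y\<bar> \<le> L * \<bar>x - y\<bar>"
begin

text \<open>Contraction by the factor \<open>1/2\<close> in the norm weighted by \<open>exp (- (2 L + 1) t)\<close>.\<close>

lemma contraction:
  assumes y: "continuous_on {0..c} y" and z: "continuous_on {0..c} z" and s: "0 \<le> s" "s \<le> c"
    and d: "0 \<le> d" "\<And>t. 0 \<le> t \<Longrightarrow> t \<le> c \<Longrightarrow> \<bar>y t - z t\<bar> \<le> d * exp ((2 * L + 1) * t)"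
  shows "\<bar>prim (prim (\<lambda>t. F t (y t))) s - prim (prim (\<lambda>t. F t (z t))) s\<bar>
         \<le> d / 2 * exp ((2 * L + 1) * s)"
proof -
  define l where "l = 2 * L + 1"
  have "2 * L \<le> l\<^sup>2" "0 < l" using L by (auto simp: l_def power2_eq_square algebra_simps)
  then have l: "l > 0" "L / l\<^sup>2 \<le> 1 / 2" by (auto simp: divide_le_eq)
  have "\<bar>F t (y t) - F t (z t)\<bar> \<le> (L * d) * exp (l * t)" if "0 \<le> t" "t \<le> s" for t
    using F_lip[of t "y t" "z t"] d(2)[of t] that s L
    by (smt (verit, best) l_def mult.assoc mult_left_mono)
  then have "\<bar>prim (prim (\<lambda>t. F t (y t) - F t (z t))) s\<bar> \<le> (L * d) / l\<^sup>2 * exp (l * s)"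
    using s l d L F_cont[OF y] F_cont[OF z]
    by (intro prim2_exp_le[where c = c]) (auto intro!: continuous_intros)
  also have "\<dots> = d * (L / l\<^sup>2) * exp (l * s)" by simp
  also have "\<dots> \<le> d * (1 / 2) * exp (l * s)"
    using l d by (intro mult_right_mono mult_left_mono) auto
  finally show ?thesis
    using prim2_diff[OF F_cont[OF y] F_cont[OF z] s] by (simp add: l_def)
qed

text \<open>In the weighted norm the contraction absorbs half of the difference of the two
  solutions, and what remains is controlled by the difference of slopes. The case
  \<open>a = b\<close> is uniqueness.\<close>

lemma volterra_lipschitz:
  assumes w: "volterra F c a w" and v: "volterra F c b v" and s: "0 \<le> s" "s \<le> c"
  shows "\<bar>w s - v s\<bar> \<le> 2 * c * exp ((2 * L + 1) * c) * \<bar>a - b\<bar>"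
proof -
  define l where "l = 2 * L + 1"
  have l: "l > 0" using L by (simp add: l_def)
  have cw: "continuous_on {0..c} w" and cv: "continuous_on {0..c} v"
    using w v by (auto simp: volterra_def)
  have "continuous_on {0..c} (\<lambda>s. exp (- (l * s)) * \<bar>w s - v s\<bar>)"
    using cw cv by (intro continuous_intros)
  moreover have "compact {0..c}" "{0..c} \<noteq> {}" using c by auto
  ultimately obtain x where x: "x \<in> {0..c}"
    "\<And>t. t \<in> {0..c} \<Longrightarrow> exp (- (l * t)) * \<bar>w t - v t\<bar> \<le> exp (- (l * x)) * \<bar>w x - v x\<bar>"
    using continuous_attains_sup by (metis (no_types, lifting))
  define d where "d = exp (- (l * x)) * \<bar>w x - v x\<bar>"
  have d0: "0 \<le> d" by (simp add: d_def)
  have d: "\<bar>w t - v t\<bar> \<le> d * exp (l * t)" if "0 \<le> t" "t \<le> c" for t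
  proof -
    have "exp (- (l * t)) * \<bar>w t - v t\<bar> \<le> d" using x(2)[of t] that by (simp add: d_def)
    then have "exp (- (l * t)) * \<bar>w t - v t\<bar> * exp (l * t) \<le> d * exp (l * t)"
      by (intro mult_right_mono) auto
    then show ?thesis by (simp add: exp_minus field_simps)
  qed
  have "\<bar>prim (prim (\<lambda>t. F t (w t))) x - prim (prim (\<lambda>t. F t (v t))) x\<bar> \<le> d / 2 * exp (l * x)"
    unfolding l_def using x(1) d0 d by (intro contraction[OF cw cv]) (auto simp: l_def)
  moreover have "w x - v x = (a - b) * x
      - (prim (prim (\<lambda>t. F t (w t))) x - prim (prim (\<lambda>t. F t (v t))) x)"
    using w v x(1) by (auto simp: volterra_def algebra_simps)
  ultimately have "\<bar>w x - v x\<bar> \<le> \<bar>(a - b) * x\<bar> + d / 2 * exp (l * x)" by linarith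
  moreover have "\<bar>(a - b) * x\<bar> \<le> \<bar>a - b\<bar> * c" using x(1) by (auto simp: abs_mult intro!: mult_left_mono)
  ultimately have "\<bar>w x - v x\<bar> \<le> \<bar>a - b\<bar> * c + d / 2 * exp (l * x)" by linarith
  \<comment> \<open>At the point \<open>x\<close> where the weighted difference attains its maximum
    \<open>d\<close>, the integral term contributes at most \<open>d / 2\<close>, which moves to the
    left-hand side.\<close>
  then have "d \<le> exp (- (l * x)) * (\<bar>a - b\<bar> * c + d / 2 * exp (l * x))"
    unfolding d_def by (intro mult_left_mono) auto
  also have "\<dots> = exp (- (l * x)) * (\<bar>a - b\<bar> * c) + d / 2"
    by (simp add: exp_minus field_simps)
  also have "exp (- (l * x)) * (\<bar>a - b\<bar> * c) \<le> 1 * (\<bar>a - b\<bar> * c)"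
    using x(1) l c by (intro mult_right_mono) auto
  finally have "d \<le> 2 * c * \<bar>a - b\<bar>" by (simp add: algebra_simps)
  then have "d * exp (l * s) \<le> 2 * c * \<bar>a - b\<bar> * exp (l * c)"
    using s l d0 c by (intro mult_mono) auto
  with d[OF s] show ?thesis by (simp add: l_def mult_ac)
qed

text \<open>Banach's fixed point theorem in the complete space of bounded continuous functions on
  the whole line.\<close>

lemma volterra_exists: "\<exists>w. volterra F c a w"
proof -
  define l where "l = 2 * L + 1"
  \<comment> \<open>Clamping to \<open>{0..c}\<close> extends functions on the interval to bounded
    continuous functions on the line.\<close>
  define k where "k s = max 0 (min c s)" for s :: real
  have k: "0 \<le> k s" "k s \<le> c" for s using c by (auto simp: k_def)
  have k_id: "k s = s" if "0 \<le> s" "s \<le> c" for s using that by (auto simp: k_def)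
  have k_cont: "continuous_on UNIV k" unfolding k_def by (intro continuous_intros)
  \<comment> \<open>The fixed point is sought for the unknown divided by \<open>exp (l * t)\<close>,
    so that the plain sup distance of \<open>y\<close> and \<open>z\<close> is the weighted distance
    of \<open>E y\<close> and \<open>E z\<close>.\<close>
  define E where "E y t = exp (l * t) * apply_bcontfun y t" for y :: "real \<Rightarrow>\<^sub>C real" and t
  have E_cont: "continuous_on {0..c} (E y)" for y
    unfolding E_def by (intro continuous_intros) simp
  define G where "G y s = exp (- (l * s)) * (a * s - prim (prim (\<lambda>t. F t (E y t))) s)" for y s
  have G_cont: "continuous_on {0..c} (G y)" for y
    unfolding G_def by (intro continuous_intros prim_cont F_cont E_cont)
  have Gk: "(\<lambda>s. G y (k s)) \<in> bcontfun" for y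
  proof -
    have "continuous_on UNIV (\<lambda>s. G y (k s))"
      by (rule continuous_on_compose2[OF G_cont k_cont]) (use k in auto)
    moreover obtain B where "\<And>s. 0 \<le> s \<Longrightarrow> s \<le> c \<Longrightarrow> \<bar>G y s\<bar> \<le> B"
      using continuous_bounded_on_Icc[OF G_cont] by blast
    then have "norm (G y (k s)) \<le> B" for s using k[of s] by auto
    ultimately show ?thesis by (intro bcontfun_normI)
  qed
  define T where "T y = Bcontfun (\<lambda>s. G y (k s))" for y
  have T: "apply_bcontfun (T y) s = G y (k s)" for y s
    unfolding T_def by (subst Bcontfun_inverse[OF Gk]) simp
  have "\<exists>!y. T y = y"
  proof (rule banach_fix_type[of "1/2"]; (intro allI)?)
    fix y z
    show "dist (T y) (T z) \<le> 1 / 2 * dist y z"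
    proof (rule dist_bound)
      fix s
      define r where "r = k s"
      have r: "0 \<le> r" "r \<le> c" using k by (auto simp: r_def)
      have "\<bar>E y t - E z t\<bar> \<le> dist y z * exp (l * t)" for t
      proof -
        have "\<bar>E y t - E z t\<bar> = exp (l * t) * dist (apply_bcontfun y t) (apply_bcontfun z t)"
          by (simp add: E_def dist_real_def abs_mult flip: right_diff_distrib)
        also have "\<dots> \<le> exp (l * t) * dist y z"
          by (intro mult_left_mono dist_bounded) auto
        finally show ?thesis by (simp add: mult.commute)
      qed
      then have *: "\<bar>prim (prim (\<lambda>t. F t (E y t))) r - prim (prim (\<lambda>t. F t (E z t))) r\<bar>
          \<le> dist y z / 2 * exp (l * r)"
        unfolding l_def by (intro contraction[OF E_cont E_cont r]) auto
      have "dist (T y s) (T z s) = exp (- (l * r)) *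
          \<bar>prim (prim (\<lambda>t. F t (E y t))) r - prim (prim (\<lambda>t. F t (E z t))) r\<bar>"
        by (simp add: T r_def[symmetric] G_def dist_real_def abs_minus_commute abs_mult
            flip: right_diff_distrib)
      also have "\<dots> \<le> exp (- (l * r)) * (dist y z / 2 * exp (l * r))"
        by (intro mult_left_mono *) auto
      finally show "dist (T y s) (T z s) \<le> 1 / 2 * dist y z"
        by (simp add: exp_minus field_simps)
    qed
  qed auto
  then obtain y where y: "T y = y" by blast
  have "volterra F c a (E y)"
    unfolding volterra_def
  proof (intro conjI ballI E_cont)
    fix s assume "s \<in> {0..c}"
    then have "apply_bcontfun y s = G y s" using T[of y s] k_id[of s] y by simp
    then show "E y s = a * s - prim (prim (\<lambda>t. F t (E y t))) s"
      by (subst E_def) (simp add: G_def exp_minus)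
  qed
  then show ?thesis by blast
qed

end

section \<open>Shooting\<close>

locale emden_fowler =
  fixes p M :: real and h :: "real \<Rightarrow> real"
  assumes p: "p > 1" and h_cont: "continuous_on {0..} h"
    and h_pos: "\<And>s. s > 0 \<Longrightarrow> h s > 0" and h_le: "\<And>s. s \<ge> 0 \<Longrightarrow> h s \<le> M"
begin

lemma h_nonneg: "0 \<le> s \<Longrightarrow> 0 \<le> h s"
proof -
  have "closure {0<..} = {0::real..}" by simp
  then show "0 \<le> s \<Longrightarrow> 0 \<le> h s"
    using continuous_ge_on_closure[of "{0<..}" h s 0] h_cont h_pos by (simp add: less_imp_le)
qed

lemma M_pos: "0 < M"
  using h_pos[of 1] h_le[of 1] by simp

lemma h_cont': "continuous_on {0..c} h"
  using h_cont by (rule continuous_on_subset) auto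

definition force :: "(real \<Rightarrow> real) \<Rightarrow> real \<Rightarrow> real" where
  "force w t = h t * pospow p (w t)"

text \<open>Integral form of w'' = -\<open>force w\<close>, w(0) = 0, w'(0) = a. No sign is imposed
  on \<open>w\<close>, so the solution may be followed beyond a zero.\<close>

definition shoot :: "real \<Rightarrow> real \<Rightarrow> (real \<Rightarrow> real) \<Rightarrow> bool" where
  "shoot c a w \<longleftrightarrow> continuous_on {0..c} w \<and> (\<forall>s\<in>{0..c}. w s = a * s - prim (prim (force w)) s)"

lemma force_cont: "continuous_on {0..c} w \<Longrightarrow> continuous_on {0..c} (force w)"
  unfolding force_def by (intro continuous_intros h_cont' pospow_comp_cont p)

lemma force_nonneg: "0 \<le> t \<Longrightarrow> 0 \<le> force w t"
  by (simp add: force_def h_nonneg)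

lemma force_le: "0 \<le> t \<Longrightarrow> w t \<le> B \<Longrightarrow> force w t \<le> M * pospow p B"
  unfolding force_def using h_le h_nonneg M_pos p by (intro mult_mono pospow_mono) auto

lemma shoot_cont: "shoot c a w \<Longrightarrow> continuous_on {0..c} w"
  and shoot_eq: "shoot c a w \<Longrightarrow> 0 \<le> s \<Longrightarrow> s \<le> c \<Longrightarrow> w s = a * s - prim (prim (force w)) s"
  by (auto simp: shoot_def)

lemma shoot_restrict: "shoot c a w \<Longrightarrow> c' \<le> c \<Longrightarrow> shoot c' a w"
  unfolding shoot_def by (auto intro: continuous_on_subset)

lemma shoot_le:
  assumes "shoot c a w" "0 \<le> s" "s \<le> c"
  shows "w s \<le> a * s"
proof -
  have "0 \<le> prim (prim (force w)) s"
    using prim2_diff_bounds(1)[OF force_cont[OF shoot_cont[OF assms(1)]], of 0 s] assms force_nonneg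
    by simp
  then show ?thesis using shoot_eq[OF assms] by simp
qed

lemma shoot_ge:
  assumes "shoot c a w" "0 \<le> s" "s \<le> c" "\<And>t. 0 \<le> t \<Longrightarrow> t \<le> s \<Longrightarrow> w t \<le> B"
  shows "a * s - M * pospow p B * s\<^sup>2 \<le> w s"
proof -
  have "\<bar>prim (prim (force w)) s\<bar> \<le> M * pospow p B * s\<^sup>2"
    using assms force_nonneg by (intro prim2_le[OF force_cont[OF shoot_cont[OF assms(1)]]])
      (auto intro!: force_le)
  then show ?thesis using shoot_eq[OF assms(1-3)] by linarith
qed

lemma shoot_lower:
  assumes "shoot c a w" "0 \<le> s" "s \<le> c" "0 \<le> a"
  shows "a * s - M * (a * s) powr p * s\<^sup>2 \<le> w s"
proof -
  have "w t \<le> a * s" if "0 \<le> t" "t \<le> s" for t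
    using shoot_le[OF assms(1), of t] that assms mult_left_mono[of t s a] by linarith
  from shoot_ge[OF assms(1-3) this] show ?thesis using assms by (simp add: pospow_def)
qed

text \<open>\<open>w\<close> is a linear function minus the convex
  \<open>prim (prim (force w))\<close>. Denominators are cleared so that coinciding points need no
  separate case.\<close>

lemma shoot_concave:
  assumes "shoot c a w" "0 \<le> x" "x \<le> y" "y \<le> z" "z \<le> c"
  shows "(z - y) * w x + (y - x) * w z \<le> (z - x) * w y"
proof -
  let ?V = "prim (prim (force w))"
  have fc: "continuous_on {0..c} (force w)" by (intro force_cont shoot_cont[OF assms(1)])
  have "?V y - ?V x \<le> (y - x) * prim (force w) y" "(z - y) * prim (force w) y \<le> ?V z - ?V y"
    using prim2_diff_bounds[OF fc] assms force_nonneg by auto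
  then have "(z - y) * (?V y - ?V x) \<le> (z - y) * ((y - x) * prim (force w) y)"
    "(y - x) * ((z - y) * prim (force w) y) \<le> (y - x) * (?V z - ?V y)"
    using assms by (auto intro!: mult_left_mono)
  then have "(z - y) * (?V y - ?V x) \<le> (y - x) * (?V z - ?V y)" by (simp add: mult_ac)
  moreover have eqs: "w x = a * x - ?V x" "w y = a * y - ?V y" "w z = a * z - ?V z"
    using assms by (auto intro!: shoot_eq[OF assms(1)])
  ultimately show ?thesis unfolding eqs by (simp add: algebra_simps)
qed

section \<open>Positivity near the origin and before zeros\<close>

lemma small_scale: "0 < k \<Longrightarrow> \<exists>e>0. \<forall>x. 0 < x \<longrightarrow> x \<le> e \<longrightarrow> k * x powr p < x"
proof -
  assume k: "0 < k"
  \<comment> \<open>The point at which \<open>k * x powr (p - 1)\<close> equals 1/2.\<close>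
  define e where "e = (1 / (2 * k)) powr (1 / (p - 1))"
  have "k * x powr p < x" if x: "0 < x" "x \<le> e" for x
  proof -
    have "x powr (p - 1) \<le> e powr (p - 1)" using x p by (intro powr_mono2) auto
    also have "\<dots> = 1 / (2 * k)" using p k by (simp add: e_def powr_powr)
    finally have "k * x powr (p - 1) < 1" using k by (simp add: field_simps)
    then have "k * x powr (p - 1) * x < 1 * x" using x by (intro mult_strict_right_mono)
    also have "k * x powr (p - 1) * x = k * x powr p"
      using x powr_add[of x "p - 1" 1] by simp
    finally show ?thesis by simp
  qed
  moreover have "e > 0" using k by (simp add: e_def)
  ultimately show ?thesis by blast
qed

text \<open>The linear term \<open>a * s\<close> beats the superlinear correction in
  \<open>shoot_lower\<close>. The threshold concerns only the product \<open>a * s\<close>, so it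
  serves both small slopes at \<open>s = c\<close> and a fixed slope near
  \<open>s = 0\<close>.\<close>

lemma shoot_small:
  assumes "0 < c"
  shows "\<exists>e>0. \<forall>a s w. 0 < a \<longrightarrow> 0 < s \<longrightarrow> s \<le> c \<longrightarrow> a * s \<le> e \<longrightarrow> shoot c a w \<longrightarrow> 0 < w s"
proof -
  obtain e where e: "e > 0" "\<And>x. 0 < x \<Longrightarrow> x \<le> e \<Longrightarrow> (M * c\<^sup>2) * x powr p < x"
    using small_scale[of "M * c\<^sup>2"] M_pos assms by auto
  have "0 < w s" if "0 < a" "0 < s" "s \<le> c" "a * s \<le> e" "shoot c a w" for a s w
  proof -
    have "M * (a * s) powr p * s\<^sup>2 \<le> M * (a * s) powr p * c\<^sup>2"
      using that M_pos by (intro mult_left_mono power_mono) auto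
    also have "\<dots> < a * s" using e(2)[of "a * s"] that by (simp add: mult_ac)
    finally show ?thesis using shoot_lower[OF that(5), of s] that by simp
  qed
  then show ?thesis using e(1) by blast
qed

text \<open>A point \<open>x\<close> close to 0 has \<open>0 < w x\<close>; concavity between
  \<open>x\<close> and \<open>c\<close>, where \<open>w\<close> is nonnegative, carries positivity
  to \<open>s\<close>.\<close>

lemma shoot_pos_interior:
  assumes w: "shoot c a w" and a: "0 < a" and s: "0 < s" "s < c" and wc: "0 \<le> w c"
  shows "0 < w s"
proof -
  obtain e where e: "e > 0" "\<And>x. 0 < x \<Longrightarrow> x \<le> c \<Longrightarrow> a * x \<le> e \<Longrightarrow> 0 < w x"
    using shoot_small[of c] a w s by (metis less_trans)
  define x where "x = min (s / 2) (e / a)"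
  have x: "0 < x" "x < s" "a * x \<le> e" using s e a by (auto simp: x_def min_def field_simps)
  have "0 < w x" using e(2)[of x] x s by simp
  then have "0 < (c - s) * w x" using s by simp
  also have "\<dots> \<le> (c - s) * w x + (s - x) * w c" using x s wc by simp
  also have "\<dots> \<le> (c - x) * w s" using x s by (intro shoot_concave[OF w]) auto
  finally show ?thesis using x s by (simp add: zero_less_mult_iff)
qed

lemma shoot_neg_after_zero:
  assumes "shoot c a w" "0 < a" "0 < c1" "c1 < c" "w c1 = 0"
  shows "w c < 0"
  using shoot_pos_interior[OF assms(1,2,3,4)] assms(5) by linarith

section \<open>Passage to the boundary value problem\<close>

lemma shoot_deriv:
  assumes w: "shoot c a w" and s: "0 < s" "s < c"
  shows "(w has_real_derivative a - prim (force w) s) (at s)"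
    "((\<lambda>s. a - prim (force w) s) has_real_derivative - force w s) (at s)"
proof -
  have fc: "continuous_on {0..c} (force w)" by (intro force_cont shoot_cont[OF w])
  have "((\<lambda>s. a * s - prim (prim (force w)) s) has_real_derivative a - prim (force w) s) (at s)"
    using prim_deriv[OF prim_cont[OF fc] s] by (auto intro!: derivative_eq_intros)
  then show "(w has_real_derivative a - prim (force w) s) (at s)"
    by (rule has_field_derivative_transform_within_open[of _ _ _ "{0<..<c}"])
      (use s shoot_eq[OF w] in auto)
  show "((\<lambda>s. a - prim (force w) s) has_real_derivative - force w s) (at s)"
    using prim_deriv[OF fc s] by (auto intro!: derivative_eq_intros)
qed

lemma abs_powr_eq_pospow: "0 < x \<Longrightarrow> \<bar>x\<bar> powr (p - 1) * x = pospow p x"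
  using powr_add[of x "p - 1" 1] by (simp add: pospow_def)

text \<open>The zero at \<open>c\<close> already forces positivity inside, and for positive values
  the cut-off nonlinearity agrees with the original one.\<close>

lemma shoot_dirichlet:
  assumes w: "shoot c a w" and a: "0 < a" and c: "0 < c" and wc: "w c = 0"
  shows "dirichlet_pos_sol h p c w"
proof -
  have pos: "0 < w s" if "s \<in> {0<..<c}" for s
    using shoot_pos_interior[OF w a, of s] that wc by simp
  have "w 0 = 0" using shoot_eq[OF w, of 0] c by simp
  moreover have "ode_sol_on h p {0<..<c} w"
    unfolding ode_sol_on_def
    using shoot_deriv[OF w] pos
    by (intro exI[of _ "\<lambda>s. a - prim (force w) s"] exI[of _ "\<lambda>s. - force w s"])
      (auto simp: force_def mult.assoc abs_powr_eq_pospow)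
  ultimately show ?thesis
    unfolding dirichlet_pos_sol_def using shoot_cont[OF w] pos wc by auto
qed

text \<open>Equal functions have equal integral terms, hence \<open>a * c = b * c\<close>. This
  turns different slopes into solutions that differ on \<open>{0..c}\<close>.\<close>

lemma shoot_slope_unique:
  assumes "shoot c a w" "shoot c b v" "0 < c" "\<And>s. s \<in> {0..c} \<Longrightarrow> w s = v s"
  shows "a = b"
proof -
  have "prim (prim (force w)) c = prim (prim (force v)) c"
    using assms(4) by (intro prim2_cong) (auto simp: force_def)
  moreover have "w c = v c" using assms by auto
  ultimately have "a * c = b * c"
    using shoot_eq[OF assms(1), of c] shoot_eq[OF assms(2), of c] assms(3) by simp
  then show ?thesis using assms(3) by simp
qed

section \<open>Existence and dependence on the slope\<close>

text \<open>Solutions of slope at most \<open>A\<close> stay below \<open>A c\<close>, so cutting the nonlinearity there makes it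
  globally Lipschitz without changing them.\<close>

lemma truncated_rhs:
  assumes "0 < c" "0 \<le> A"
  shows "volterra_rhs (\<lambda>t x. h t * pospow p (min x (A * c))) c (M * (p * (A * c) powr (p - 1)))"
proof
  show "0 \<le> c" "0 \<le> M * (p * (A * c) powr (p - 1))" using assms M_pos p by auto
next
  fix y :: "real \<Rightarrow> real" assume "continuous_on {0..c} y"
  then show "continuous_on {0..c} (\<lambda>t. h t * pospow p (min (y t) (A * c)))"
    by (intro continuous_intros h_cont' pospow_comp_cont p)
next
  fix t x y :: real assume t: "0 \<le> t" "t \<le> c"
  have "\<bar>h t * pospow p (min x (A * c)) - h t * pospow p (min y (A * c))\<bar>
      = h t * \<bar>pospow p (min x (A * c)) - pospow p (min y (A * c))\<bar>"
    using h_nonneg[OF t(1)] by (simp add: abs_mult flip: right_diff_distrib)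
  also have "\<dots> \<le> M * (p * (A * c) powr (p - 1) * \<bar>min x (A * c) - min y (A * c)\<bar>)"
    using t h_le h_nonneg M_pos assms p by (intro mult_mono pospow_lipschitz) auto
  also have "\<dots> \<le> M * (p * (A * c) powr (p - 1) * \<bar>x - y\<bar>)"
    using M_pos p by (intro mult_left_mono) auto
  finally show "\<bar>h t * pospow p (min x (A * c)) - h t * pospow p (min y (A * c))\<bar>
      \<le> M * (p * (A * c) powr (p - 1)) * \<bar>x - y\<bar>" by (simp add: mult.assoc)
qed

lemma shoot_volterra:
  assumes "shoot c a w" "0 \<le> a" "a \<le> A" "0 < c"
  shows "volterra (\<lambda>t x. h t * pospow p (min x (A * c))) c a w"
  unfolding volterra_def
proof (intro conjI ballI)
  show "continuous_on {0..c} w" by (rule shoot_cont[OF assms(1)])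
  fix s assume s: "s \<in> {0..c}"
  have "w t \<le> A * c" if "0 \<le> t" "t \<le> c" for t
    using shoot_le[OF assms(1) that] mult_mono[of a A t c] that assms by linarith
  then have "prim (prim (\<lambda>t. h t * pospow p (min (w t) (A * c)))) s = prim (prim (force w)) s"
    using s by (intro prim2_cong) (auto simp: force_def min_def)
  then show "w s = a * s - prim (prim (\<lambda>t. h t * pospow p (min (w t) (A * c)))) s"
    using shoot_eq[OF assms(1)] s by simp
qed

text \<open>A single truncation level \<open>A * c\<close>, hence a single constant, serves all
  slopes in \<open>{0..A}\<close>. With \<open>a = b\<close> the bound is 0, which is how uniqueness
  is used below.\<close>

lemma shoot_lipschitz:
  assumes "0 < c" "0 \<le> A"
  shows "\<exists>C. \<forall>a\<in>{0..A}. \<forall>b\<in>{0..A}. \<forall>w v. shoot c a w \<longrightarrow> shoot c b v \<longrightarrow>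
    (\<forall>s\<in>{0..c}. \<bar>w s - v s\<bar> \<le> C * \<bar>a - b\<bar>)"
  using volterra_rhs.volterra_lipschitz[OF truncated_rhs[OF assms] shoot_volterra shoot_volterra]
    assms by (intro exI) auto

text \<open>The solution of the truncated problem lies below \<open>a * s\<close>, hence below the
  truncation level, so it also solves the original problem.\<close>

lemma shoot_exists:
  assumes "0 < c" "0 \<le> a"
  shows "\<exists>w. shoot c a w"
proof -
  obtain w where w: "volterra (\<lambda>t x. h t * pospow p (min x (a * c))) c a w"
    using volterra_rhs.volterra_exists[OF truncated_rhs[OF assms]] by blast
  let ?f = "\<lambda>t. h t * pospow p (min (w t) (a * c))"
  have wc: "continuous_on {0..c} w" using w by (simp add: volterra_def)
  have fc: "continuous_on {0..c} ?f" by (intro continuous_intros h_cont' pospow_comp_cont p wc)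
  have "w s \<le> a * c" if "0 \<le> s" "s \<le> c" for s
  proof -
    have "0 \<le> prim (prim ?f) s"
      using prim2_diff_bounds(1)[OF fc, of 0 s] that h_nonneg by simp
    then have "w s \<le> a * s" using w that by (simp add: volterra_def)
    also have "\<dots> \<le> a * c" using that assms by (intro mult_left_mono) auto
    finally show ?thesis .
  qed
  then have "prim (prim ?f) s = prim (prim (force w)) s" if "s \<in> {0..c}" for s
    using that by (intro prim2_cong) (auto simp: force_def min_def)
  then have "shoot c a w" using w by (auto simp: shoot_def volterra_def)
  then show ?thesis by blast
qed

text \<open>If \<open>w c\<close> were nonnegative, concavity would keep \<open>w\<close> above half
  its midpoint value \<open>q\<close> on \<open>{c/2..3*c/4}\<close>. The force there, integrated
  twice, is of order q^p but can be at most of order q, so \<open>q\<close> is bounded by some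
  \<open>Q\<close> independent of the slope. Then \<open>w\<close> is bounded by
  \<open>2 * Q\<close> on the first half, and this bounds the slope.\<close>

lemma shoot_large:
  assumes c: "0 < c"
  shows "\<exists>A>0. \<forall>a w. A \<le> a \<longrightarrow> shoot c a w \<longrightarrow> w c < 0"
proof -
  have "compact {c/2..3*c/4}" "{c/2..3*c/4} \<noteq> {}" "continuous_on {c/2..3*c/4} h"
    using c h_cont by (auto intro: continuous_on_subset)
  then obtain x where x: "x \<in> {c/2..3*c/4}" "\<And>t. t \<in> {c/2..3*c/4} \<Longrightarrow> h x \<le> h t"
    using continuous_attains_inf by metis
  define m where "m = h x"
  have m: "0 < m" using h_pos x(1) c by (simp add: m_def)
  \<comment> \<open>\<open>Q\<close> is the bound on \<open>q\<close> obtained from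
    \<open>(c / 4)^2 * m * (q / 2) powr (p - 1) \<le> 4\<close>; \<open>A\<close> is then chosen so
    that slope \<open>A\<close> would give a midpoint value of at least
    \<open>1 + Q\<close>.\<close>
  define Q where "Q = 2 * (64 / (c\<^sup>2 * m)) powr (1 / (p - 1))"
  define A where "A = 2 / c * (1 + Q + M * pospow p (2 * Q) * (c / 2)\<^sup>2)"
  have Q: "0 \<le> Q" by (simp add: Q_def)
  have "0 < 1 + Q + M * pospow p (2 * Q) * (c / 2)\<^sup>2"
    using Q M_pos by (intro add_pos_nonneg mult_nonneg_nonneg) auto
  then have A: "0 < A" using c by (simp add: A_def)
  have "w c < 0" if a: "A \<le> a" and w: "shoot c a w" for a w
  proof (rule ccontr)
    assume "\<not> w c < 0"
    then have wc: "0 \<le> w c" by simp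
    define q where "q = w (c / 2)"
    have q: "0 < q" using shoot_pos_interior[OF w _ _ _ wc, of "c / 2"] a A c by (simp add: q_def)
    have fc: "continuous_on {0..c} (force w)" by (intro force_cont shoot_cont[OF w])
    let ?U = "prim (force w)"
    let ?V = "prim ?U"
    have low: "q / 2 \<le> w t" if "c / 2 \<le> t" "t \<le> 3 * c / 4" for t
    proof -
      have "(c - t) * q + (t - c / 2) * w c \<le> (c - c / 2) * w t"
        unfolding q_def using that c by (intro shoot_concave[OF w]) auto
      moreover have "0 \<le> (t - c / 2) * w c" using that wc by simp
      moreover have "(c / 4) * q \<le> (c - t) * q" using that q by (intro mult_right_mono) auto
      ultimately have "(c / 4) * q \<le> (c / 2) * w t" by simp
      then show ?thesis using c by (simp add: field_simps)
    qed
    have force_low: "m * (q / 2) powr p \<le> force w t" if "c / 2 \<le> t" "t \<le> 3 * c / 4" for t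
    proof -
      have "pospow p (q / 2) \<le> pospow p (w t)" using low[OF that] p by (intro pospow_mono) auto
      then have "(q / 2) powr p \<le> pospow p (w t)" using q by (simp add: pospow_def)
      moreover have "m \<le> h t" using x(2)[of t] that by (simp add: m_def)
      ultimately show ?thesis unfolding force_def using m by (intro mult_mono) auto
    qed
    obtain B where "\<And>t. 0 \<le> t \<Longrightarrow> t \<le> c \<Longrightarrow> \<bar>force w t\<bar> \<le> B"
      using continuous_bounded_on_Icc[OF fc] by blast
    then have "force w t \<le> B" if "0 \<le> t" "t \<le> c" for t
      using that abs_le_D1 by blast
    then have "m * (q / 2) powr p \<le> force w t \<and> force w t \<le> B"
      if "c / 2 \<le> t" "t \<le> 3 * c / 4" for t
      using force_low[OF that] that c by simp
    from prim_diff_bounds(1)[OF fc _ _ _ this, of "c / 2" "3 * c / 4"]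
    have "(c / 4) * (m * (q / 2) powr p) \<le> ?U (3 * c / 4) - ?U (c / 2)"
      using c by (simp add: field_simps)
    then have "(c / 4) * ((c / 4) * (m * (q / 2) powr p)) \<le> (c / 4) * (?U (3 * c / 4) - ?U (c / 2))"
      using c by (intro mult_left_mono) auto
    \<comment> \<open>The right-hand side is the second difference of \<open>?V\<close> at 0,
      \<open>c / 2\<close>, \<open>c\<close>; the linear part \<open>a * s\<close> of
      \<open>w\<close> cancels in it, which leaves \<open>2 * q - w c\<close>.\<close>
    also have "\<dots> \<le> ?V c - 2 * ?V (c / 2)"
    proof -
      have "(c / 2 - 0) * ?U (c / 2) \<ge> ?V (c / 2) - ?V 0"
        "(3 * c / 4 - c / 2) * ?U (c / 2) \<le> ?V (3 * c / 4) - ?V (c / 2)"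
        "(c - 3 * c / 4) * ?U (3 * c / 4) \<le> ?V c - ?V (3 * c / 4)"
        using c force_nonneg by (intro prim2_diff_bounds[OF fc]; auto)+
      then show ?thesis by (simp add: field_simps)
    qed
    also have "\<dots> = 2 * q - w c"
      using shoot_eq[OF w, of c] shoot_eq[OF w, of "c / 2"] c by (simp add: q_def)
    finally have "(c / 4) * ((c / 4) * (m * (q / 2) powr p)) \<le> 4 * (q / 2)" using wc by simp
    moreover have "(q / 2) powr p = (q / 2) powr (p - 1) * (q / 2)"
      using powr_add[of "q / 2" "p - 1" 1] q by simp
    ultimately have "((c / 4) * ((c / 4) * m) * (q / 2) powr (p - 1)) * (q / 2) \<le> 4 * (q / 2)"
      by (simp add: mult_ac)
    then have "(c / 4) * ((c / 4) * m) * (q / 2) powr (p - 1) \<le> 4"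
      using q by (subst (asm) mult_le_cancel_right_pos) auto
    then have "(q / 2) powr (p - 1) \<le> 64 / (c\<^sup>2 * m)"
      using c m by (simp add: field_simps power2_eq_square)
    then have "((q / 2) powr (p - 1)) powr (1 / (p - 1)) \<le> (64 / (c\<^sup>2 * m)) powr (1 / (p - 1))"
      using p by (intro powr_mono2) auto
    then have qQ: "q \<le> Q" using q p by (simp add: Q_def powr_powr)
    have up: "w t \<le> 2 * Q" if "0 \<le> t" "t \<le> c / 2" for t
    proof -
      have "(c - c / 2) * w t + (c / 2 - t) * w c \<le> (c - t) * q"
        unfolding q_def using that c by (intro shoot_concave[OF w]) auto
      moreover have "0 \<le> (c / 2 - t) * w c" using that wc by simp
      moreover have "(c - t) * q \<le> c * q" using that q by (intro mult_right_mono) auto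
      ultimately have "(c / 2) * w t \<le> c * q" by simp
      then have "c * (w t / 2) \<le> c * q" by simp
      then show ?thesis using c qQ by (subst (asm) mult_le_cancel_left_pos) auto
    qed
    have "a * (c / 2) - M * pospow p (2 * Q) * (c / 2)\<^sup>2 \<le> q"
      unfolding q_def using c up by (intro shoot_ge[OF w]) auto
    moreover have "A * (c / 2) \<le> a * (c / 2)" using a c by (intro mult_right_mono) auto
    moreover have "A * (c / 2) = 1 + Q + M * pospow p (2 * Q) * (c / 2)\<^sup>2"
      using c by (simp add: A_def)
    ultimately show False using qQ by linarith
  qed
  then show ?thesis using A by blast
qed

text \<open>The equation is given only for positive \<open>s\<close>, so the slope at 0 has to be
  recovered: \<open>w' + prim (force w)\<close> has derivative zero there, and its constant value is
  \<open>a\<close>. Positivity of \<open>a\<close> follows from \<open>0 < w 1\<close> and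
  \<open>w 1 \<le> a\<close>.\<close>

lemma ode_sol_shoot:
  assumes cont: "continuous_on {0..} w" and ode: "ode_sol_on h p {0<..} w"
    and w0: "w 0 = 0" and pos: "\<And>s. s > 0 \<Longrightarrow> w s > 0"
  shows "\<exists>a>0. \<forall>c. shoot c a w"
proof -
  obtain w' w'' where D: "\<And>s. s > 0 \<Longrightarrow> (w has_real_derivative w' s) (at s)"
      "\<And>s. s > 0 \<Longrightarrow> (w' has_real_derivative w'' s) (at s)"
      "\<And>s. s > 0 \<Longrightarrow> w'' s + h s * (\<bar>w s\<bar> powr (p - 1)) * w s = 0"
    using ode unfolding ode_sol_on_def by auto
  have w'': "w'' s = - force w s" if "s > 0" for s
    using D(3)[OF that] abs_powr_eq_pospow[OF pos[OF that]] by (simp add: force_def mult.assoc)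
  have wc: "continuous_on {0..c} w" for c using cont by (rule continuous_on_subset) auto
  have fc: "continuous_on {0..c} (force w)" for c by (intro force_cont wc)
  have "\<exists>a. \<forall>s\<in>{0<..}. w' s + prim (force w) s = a"
  proof (rule has_field_derivative_zero_constant)
    fix s :: real assume "s \<in> {0<..}"
    then have "(prim (force w) has_real_derivative force w s) (at s)"
      "(w' has_real_derivative - force w s) (at s)"
      using prim_deriv[OF fc[of "s + 1"], of s] D(2)[of s] w''[of s] by auto
    from DERIV_add[OF this(2) this(1)]
    show "((\<lambda>s. w' s + prim (force w) s) has_real_derivative 0) (at s within {0<..})"
      by (auto intro: has_field_derivative_at_within)
  qed auto
  then obtain a where a: "\<And>s. s > 0 \<Longrightarrow> w' s + prim (force w) s = a" by auto
  have eq: "w s = a * s - prim (prim (force w)) s" if s: "0 \<le> s" for s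
  proof -
    have "w s + prim (prim (force w)) s - a * s = w 0 + prim (prim (force w)) 0 - a * 0"
    proof (rule DERIV_isconst2[of 0 "s + 1"])
      show "continuous_on {0..s + 1} (\<lambda>s. w s + prim (prim (force w)) s - a * s)"
        by (intro continuous_intros wc prim_cont fc)
      fix t :: real assume t: "0 < t" "t < s + 1"
      show "((\<lambda>s. w s + prim (prim (force w)) s - a * s) has_real_derivative 0) (at t)"
        using D(1)[OF t(1)] prim_deriv[OF prim_cont[OF fc] t] a[OF t(1)]
        by (auto intro!: derivative_eq_intros)
    qed (use s in auto)
    then show ?thesis using w0 by simp
  qed
  then have sh: "shoot c a w" for c unfolding shoot_def using wc by auto
  then have "w 1 \<le> a" using shoot_le[of 1 a w 1] by simp
  then have "a > 0" using pos[of 1] by simp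
  with sh show ?thesis by blast
qed

end

section \<open>The variational problem\<close>

text \<open>Cauchy-Schwarz enters through this expansion: the integrand on the left is nonnegative
  and \<open>x\<close>, \<open>y\<close> can be chosen freely.\<close>

lemma prim_square_diff:
  assumes "continuous_on {0..c} f" "continuous_on {0..c} g" "s \<le> c"
  shows "prim (\<lambda>t. (x * f t - y * g t)\<^sup>2) s =
    x\<^sup>2 * prim (\<lambda>t. (f t)\<^sup>2) s - 2 * x * y * prim (\<lambda>t. f t * g t) s + y\<^sup>2 * prim (\<lambda>t. (g t)\<^sup>2) s"
proof -
  have "prim (\<lambda>t. (x * f t - y * g t)\<^sup>2) s =
      prim (\<lambda>t. (x\<^sup>2 * (f t)\<^sup>2 - (2 * x * y) * (f t * g t)) + y\<^sup>2 * (g t)\<^sup>2) s"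
    by (intro prim_cong) (simp add: power2_eq_square algebra_simps)
  also have "\<dots> = prim (\<lambda>t. x\<^sup>2 * (f t)\<^sup>2 - (2 * x * y) * (f t * g t)) s + prim (\<lambda>t. y\<^sup>2 * (g t)\<^sup>2) s"
    by (rule prim_add[where c = c]) (intro continuous_intros assms)+
  also have "prim (\<lambda>t. x\<^sup>2 * (f t)\<^sup>2 - (2 * x * y) * (f t * g t)) s =
      prim (\<lambda>t. x\<^sup>2 * (f t)\<^sup>2) s - prim (\<lambda>t. (2 * x * y) * (f t * g t)) s"
    by (rule prim_diff[where c = c]) (intro continuous_intros assms)+
  finally show ?thesis by (simp only: prim_mult_left)
qed

text \<open>Continuously differentiable functions with zero boundary values stand in for the Sobolev
  space H^1_0. The derivative is an explicit argument because the Dirichlet integral is formed from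
  it.\<close>

definition vanishing :: "real \<Rightarrow> (real \<Rightarrow> real) \<Rightarrow> (real \<Rightarrow> real) \<Rightarrow> bool" where
  "vanishing c w w' \<longleftrightarrow> continuous_on {0..c} w' \<and> w 0 = 0 \<and> w c = 0 \<and>
     (\<forall>s\<in>{0..c}. (w has_real_derivative w' s) (at s within {0..c}))"

lemma vanishing_cont: "vanishing c w w' \<Longrightarrow> continuous_on {0..c} w"
  unfolding vanishing_def by (meson DERIV_continuous_on)

text \<open>Cauchy-Schwarz for \<open>w'\<close> against the constant 1 on \<open>{x..y}\<close>,
  obtained by integrating the square of \<open>w'\<close> minus its mean \<open>l\<close>. It
  supplies the Hoelder-1/2 equicontinuity needed for compactness.\<close>

lemma vanishing_holder:
  assumes w: "vanishing c w w'" and xy: "0 \<le> x" "x \<le> y" "y \<le> c"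
  shows "(w y - w x)\<^sup>2 \<le> (y - x) * prim (\<lambda>t. (w' t)\<^sup>2) c"
proof (cases "x = y")
  case False
  define l where "l = (w y - w x) / (y - x)"
  have wc: "continuous_on {0..c} w'" using w by (simp add: vanishing_def)
  have p: "prim w' s = w s" if "0 \<le> s" "s \<le> c" for s
    using w that by (intro prim_unique[where c = c]) (auto simp: vanishing_def)
  have q: "prim (\<lambda>t. (1 * w' t - l * 1)\<^sup>2) s = prim (\<lambda>t. (w' t)\<^sup>2) s - 2 * l * w s + l\<^sup>2 * s"
    if "0 \<le> s" "s \<le> c" for s
    using p that prim_square_diff[OF wc continuous_on_const[of _ 1] that(2), of 1 l]
    by (simp add: prim_const)
  have "prim (\<lambda>t. (1 * w' t - l * 1)\<^sup>2) x \<le> prim (\<lambda>t. (1 * w' t - l * 1)\<^sup>2) y"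
    using xy by (intro prim_incr[of c] continuous_intros wc) auto
  then have "2 * l * (w y - w x) - l\<^sup>2 * (y - x) \<le> prim (\<lambda>t. (w' t)\<^sup>2) y - prim (\<lambda>t. (w' t)\<^sup>2) x"
    using q[of x] q[of y] xy by (simp add: algebra_simps)
  also have "\<dots> \<le> prim (\<lambda>t. (w' t)\<^sup>2) c"
  proof -
    have "prim (\<lambda>t. (w' t)\<^sup>2) y \<le> prim (\<lambda>t. (w' t)\<^sup>2) c"
      using xy by (intro prim_incr[of c] continuous_intros wc) auto
    moreover have "0 \<le> prim (\<lambda>t. (w' t)\<^sup>2) x"
      using xy by (intro prim_nonneg[of c] continuous_intros wc) auto
    ultimately show ?thesis by simp
  qed
  also have "2 * l * (w y - w x) - l\<^sup>2 * (y - x) = (w y - w x)\<^sup>2 / (y - x)"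
  proof -
    have "w y - w x = l * (y - x)" using False by (simp add: l_def)
    then show ?thesis using False by (simp add: power2_eq_square)
  qed
  finally show ?thesis using False xy by (simp add: divide_le_eq mult.commute)
qed simp

lemma vanishing_le:
  assumes w: "vanishing c w w'" and s: "0 \<le> s" "s \<le> c"
  shows "(w s)\<^sup>2 \<le> s * prim (\<lambda>t. (w' t)\<^sup>2) c"
  using vanishing_holder[OF w, of 0 s] s w by (simp add: vanishing_def)

text \<open>\<open>green c f\<close> solves \<open>- g'' = f\<close>, \<open>g(0) = g(c) = 0\<close>.\<close>

definition green :: "real \<Rightarrow> (real \<Rightarrow> real) \<Rightarrow> real \<Rightarrow> real" where
  "green c f s = prim (prim f) c / c * s - prim (prim f) s"

definition green' :: "real \<Rightarrow> (real \<Rightarrow> real) \<Rightarrow> real \<Rightarrow> real" where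
  "green' c f s = prim (prim f) c / c - prim f s"

lemma green_deriv:
  assumes f: "continuous_on {0..c} f" and s: "s \<in> {0..c}"
  shows "(green c f has_real_derivative green' c f s) (at s within {0..c})"
    "(green' c f has_real_derivative - f s) (at s within {0..c})"
proof -
  have "((\<lambda>s. b * s - prim (prim f) s) has_real_derivative b - prim f s) (at s within {0..c})"
    "((\<lambda>s. b - prim f s) has_real_derivative - f s) (at s within {0..c})" for b
    using prim_deriv_within[OF f s] prim_deriv_within[OF prim_cont[OF f] s]
    by (auto intro!: derivative_eq_intros)
  then show "(green c f has_real_derivative green' c f s) (at s within {0..c})"
    "(green' c f has_real_derivative - f s) (at s within {0..c})"
    unfolding green_def green'_def by blast+
qed

lemma green_vanishing:
  assumes f: "continuous_on {0..c} f" and c: "0 < c"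
  shows "vanishing c (green c f) (green' c f)"
  unfolding vanishing_def
  using green_deriv(1)[OF f] c DERIV_continuous_on[OF green_deriv(2)[OF f]] by (auto simp: green_def)

text \<open>The boundary term vanishes with \<open>w\<close>. In the Dirichlet inner product,
  \<open>green c f\<close> is thus the Riesz representative of integration against
  \<open>f\<close>.\<close>

lemma green_by_parts:
  assumes f: "continuous_on {0..c} f" and w: "vanishing c w w'" and c: "0 < c"
  shows "prim (\<lambda>t. green' c f t * w' t) c = prim (\<lambda>t. f t * w t) c"
proof -
  have wc: "continuous_on {0..c} w'" "continuous_on {0..c} w"
    using w vanishing_cont[OF w] by (auto simp: vanishing_def)
  have gc: "continuous_on {0..c} (green' c f)"
    using green_vanishing[OF f c] by (simp add: vanishing_def)
  have "prim (\<lambda>t. green' c f t * w' t - f t * w t) c = green' c f c * w c"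
  proof (rule prim_unique[where c = c and g = "\<lambda>t. green' c f t * w t"])
    fix t assume t: "t \<in> {0..c}"
    then have "(w has_real_derivative w' t) (at t within {0..c})"
      using w by (simp add: vanishing_def)
    from DERIV_mult[OF green_deriv(2)[OF f t] this]
    show "((\<lambda>t. green' c f t * w t) has_real_derivative green' c f t * w' t - f t * w t)
        (at t within {0..c})" by (simp add: algebra_simps)
  qed (use w c in \<open>auto simp: vanishing_def\<close>)
  moreover have "prim (\<lambda>t. green' c f t * w' t - f t * w t) c
      = prim (\<lambda>t. green' c f t * w' t) c - prim (\<lambda>t. f t * w t) c"
    by (rule prim_diff[of c]) (auto intro!: continuous_intros gc wc f)
  ultimately show ?thesis using w by (simp add: vanishing_def)
qed

lemma prim_uniform_limit:
  assumes u: "uniform_limit {0..c} f g sequentially"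
    and f: "\<And>n. continuous_on {0..c} (f n)" and g: "continuous_on {0..c} g"
  shows "uniform_limit {0..c} (\<lambda>n. prim (f n)) (prim g) sequentially"
proof (rule uniform_limitI)
  fix e :: real assume e: "0 < e"
  define d where "d = e / (\<bar>c\<bar> + 1)"
  have d: "0 < d" using e by (simp add: d_def add_nonneg_pos)
  show "\<forall>\<^sub>F n in sequentially. \<forall>s\<in>{0..c}. dist (prim (f n) s) (prim g s) < e"
    using uniform_limitD[OF u d]
  proof eventually_elim
    case (elim n)
    show ?case
    proof
      fix s assume s: "s \<in> {0..c}"
      have "\<bar>prim (\<lambda>t. f n t - g t) s\<bar> \<le> prim (\<lambda>_. d) s"
        using s elim by (intro prim_abs_le[where c = c] continuous_intros f g)
          (auto simp: dist_real_def less_imp_le)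
      also have "\<dots> \<le> d * c" using s d by (simp add: prim_const)
      also have "\<dots> < d * (\<bar>c\<bar> + 1)" using d by (intro mult_strict_left_mono) auto
      also have "\<dots> = e" by (simp add: d_def add_nonneg_pos order_less_imp_not_eq2)
      finally show "dist (prim (f n) s) (prim g s) < e"
        using s by (simp add: dist_real_def prim_diff[OF f g])
    qed
  qed
qed

section \<open>Maximising the energy on the Dirichlet unit sphere\<close>

context emden_fowler
begin

definition energy :: "real \<Rightarrow> (real \<Rightarrow> real) \<Rightarrow> real" where
  "energy c w = prim (\<lambda>t. h t * pospow (p + 1) (w t)) c"

definition unit_fun :: "real \<Rightarrow> (real \<Rightarrow> real) \<Rightarrow> (real \<Rightarrow> real) \<Rightarrow> bool" where
  "unit_fun c w w' \<longleftrightarrow> vanishing c w w' \<and> prim (\<lambda>t. (w' t)\<^sup>2) c = 1"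

text \<open>The bound does not depend on \<open>c\<close>; this is what later controls the initial
  slope through the fixed interval \<open>{0..1}\<close>.\<close>

lemma unit_fun_le:
  assumes "unit_fun c w w'" "0 \<le> s" "s \<le> c"
  shows "\<bar>w s\<bar> \<le> sqrt s"
  using vanishing_le[of c w w' s] assms by (simp add: unit_fun_def real_le_rsqrt)

lemma energy_cont: "continuous_on {0..c} w \<Longrightarrow> continuous_on {0..c} (\<lambda>t. h t * pospow (p + 1) (w t))"
  using p by (intro continuous_intros h_cont' pospow_comp_cont) auto

lemma energy_force: "prim (\<lambda>t. force w t * w t) c = energy c w"
  unfolding energy_def force_def using p by (simp add: mult.assoc pospow_mult)

lemma energy_le:
  assumes w: "continuous_on {0..c} w" and c: "0 \<le> c" and B: "\<And>t. 0 \<le> t \<Longrightarrow> t \<le> c \<Longrightarrow> w t \<le> B"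
  shows "energy c w \<le> M * pospow (p + 1) B * c"
proof -
  have "energy c w \<le> prim (\<lambda>_. M * pospow (p + 1) B) c"
    unfolding energy_def using h_le h_nonneg M_pos p B
    by (intro prim_mono[OF energy_cont[OF w]] mult_mono pospow_mono) auto
  then show ?thesis using c by (simp add: prim_const)
qed

text \<open>The pointwise tangent inequality, multiplied by \<open>h\<close> and integrated:
  \<open>(p + 1)\<close> times the force is the derivative of the energy density.\<close>

lemma energy_tangent:
  assumes w: "continuous_on {0..c} w" and v: "continuous_on {0..c} v" and c: "0 \<le> c"
  shows "energy c w + (p + 1) * (prim (\<lambda>t. force w t * v t) c - energy c w) \<le> energy c v"
proof -
  have fc: "continuous_on {0..c} (force w)" by (rule force_cont[OF w])
  have "prim (\<lambda>t. h t * pospow (p + 1) (w t) + (p + 1) * (force w t * v t - force w t * w t)) c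
      \<le> energy c v"
    unfolding energy_def
  proof (rule prim_mono[where c = c])
    fix t assume t: "0 \<le> t" "t \<le> c"
    have "h t * (pospow (p + 1) (w t) + (p + 1) * pospow p (w t) * (v t - w t)) \<le> h t * pospow (p + 1) (v t)"
      using h_nonneg[OF t(1)] p by (intro mult_left_mono pospow_tangent) auto
    then show "h t * pospow (p + 1) (w t) + (p + 1) * (force w t * v t - force w t * w t)
        \<le> h t * pospow (p + 1) (v t)" by (simp add: force_def algebra_simps)
  qed (auto intro!: continuous_intros energy_cont w v fc)
  moreover have "prim (\<lambda>t. h t * pospow (p + 1) (w t) + (p + 1) * (force w t * v t - force w t * w t)) c
      = energy c w + (p + 1) * (prim (\<lambda>t. force w t * v t) c - prim (\<lambda>t. force w t * w t) c)"
    unfolding energy_def prim_mult_left[symmetric]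
    by (simp add: prim_add[where c = c] prim_diff[where c = c] prim_mult_left
        continuous_intros energy_cont w v fc)
  ultimately show ?thesis by (simp add: energy_force)
qed

text \<open>\<open>N\<close> is the Dirichlet norm of \<open>green c (force w)\<close>. Convexity of the energy turns near-maximality
  of \<open>w\<close> into smallness of one step of the normalised power iteration.\<close>

lemma power_step:
  assumes c: "0 < c" and w: "unit_fun c w w'" and J: "0 < energy c w"
    and S: "\<And>v v'. unit_fun c v v' \<Longrightarrow> energy c v \<le> S"
  shows "\<exists>N. energy c w \<le> N \<and> N - energy c w \<le> (S - energy c w) / (p + 1) \<and>
    (\<forall>s\<in>{0..c}. (green c (force w) s / N - w s)\<^sup>2 \<le> c * (2 * (N - energy c w) / N))"
proof -
  let ?g = "green c (force w)" and ?g' = "green' c (force w)" and ?J = "energy c w"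
  have van: "vanishing c w w'" and one: "prim (\<lambda>t. (w' t)\<^sup>2) c = 1"
    using w by (auto simp: unit_fun_def)
  have wc: "continuous_on {0..c} w" "continuous_on {0..c} w'"
    using van vanishing_cont[OF van] by (auto simp: vanishing_def)
  have fc: "continuous_on {0..c} (force w)" by (rule force_cont[OF wc(1)])
  have gv: "vanishing c ?g ?g'" by (rule green_vanishing[OF fc c])
  have gc: "continuous_on {0..c} ?g" "continuous_on {0..c} ?g'"
    using gv vanishing_cont[OF gv] by (auto simp: vanishing_def)
  define A where "A = prim (\<lambda>t. (?g' t)\<^sup>2) c"
  define N where "N = sqrt A"
  have gw: "prim (\<lambda>t. ?g' t * w' t) c = ?J"
    using green_by_parts[OF fc van c] by (simp add: energy_force)
  have fg: "prim (\<lambda>t. force w t * ?g t) c = A"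
    using green_by_parts[OF fc gv c] by (simp add: A_def power2_eq_square)
  have comb: "prim (\<lambda>t. (x * ?g' t - y * w' t)\<^sup>2) c = x\<^sup>2 * A - 2 * x * y * ?J + y\<^sup>2" for x y
    using prim_square_diff[OF gc(2) wc(2), of c x y] by (simp add: A_def gw one)
  \<comment> \<open>Cauchy-Schwarz: by \<open>comb\<close> this integral equals \<open>A\<close>
    minus the square of \<open>?J\<close>.\<close>
  have "0 \<le> prim (\<lambda>t. (1 * ?g' t - ?J * w' t)\<^sup>2) c"
    by (intro prim_nonneg[where c = c] continuous_intros gc wc) auto
  then have "?J\<^sup>2 \<le> A" unfolding comb by (simp add: power2_eq_square)
  then have JN: "?J \<le> N" unfolding N_def by (rule real_le_rsqrt)
  have "0 \<le> A" using \<open>?J\<^sup>2 \<le> A\<close> zero_le_power2[of ?J] by linarith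
  then have "N\<^sup>2 = A" by (simp add: N_def)
  moreover have "0 < N" using J JN by linarith
  ultimately have N: "0 < N" "N\<^sup>2 = A" by simp_all
  \<comment> \<open>The normalised iterate is a competitor, so its energy is at most
    \<open>S\<close>, while the tangent inequality at \<open>w\<close> makes it at least
    \<open>?J + (p + 1) * (N - ?J)\<close>.\<close>
  define v where "v t = 1 / N * ?g t" for t
  define v' where "v' t = 1 / N * ?g' t" for t
  have vv: "vanishing c v v'"
    using gv N(1) unfolding vanishing_def v_def v'_def
    by (auto intro!: continuous_intros derivative_eq_intros)
  have "prim (\<lambda>t. (v' t)\<^sup>2) c = (1 / N)\<^sup>2 * A"
    using comb[of "1 / N" 0] by (simp add: v'_def)
  also have "\<dots> = 1" using N(1) unfolding N(2)[symmetric] by (simp add: power_divide)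
  finally have vu: "unit_fun c v v'" using vv by (simp add: unit_fun_def)
  have "prim (\<lambda>t. force w t * v t) c = 1 / N * prim (\<lambda>t. force w t * ?g t) c"
    unfolding prim_mult_left[symmetric] by (rule prim_cong) (simp add: v_def)
  also have "\<dots> = N" using N(1) unfolding fg N(2)[symmetric] by (simp add: power2_eq_square)
  finally have "?J + (p + 1) * (N - ?J) \<le> energy c v"
    using energy_tangent[OF wc(1) vanishing_cont[OF vv]] c by simp
  also have "\<dots> \<le> S" by (rule S[OF vu])
  finally have NS: "N - ?J \<le> (S - ?J) / (p + 1)" using p by (simp add: field_simps)
  have dv: "vanishing c (\<lambda>t. v t - w t) (\<lambda>t. v' t - w' t)"
    using vv van unfolding vanishing_def
    by (auto intro!: continuous_intros derivative_eq_intros)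
  \<comment> \<open>Both functions are unit vectors with inner product \<open>?J / N\<close>, so the
    squared distance is \<open>2 - 2 * ?J / N\<close>.\<close>
  have "prim (\<lambda>t. (v' t - w' t)\<^sup>2) c = (1 / N)\<^sup>2 * A - 2 * (1 / N) * ?J + 1"
    using comb[of "1 / N" 1] by (simp add: v'_def)
  also have "\<dots> = 2 * (N - ?J) / N"
    using N(1) unfolding N(2)[symmetric] by (simp add: power2_eq_square field_simps)
  finally have E: "prim (\<lambda>t. (v' t - w' t)\<^sup>2) c = 2 * (N - ?J) / N" .
  have "(?g s / N - w s)\<^sup>2 \<le> c * (2 * (N - ?J) / N)" if "0 \<le> s" "s \<le> c" for s
  proof -
    have "(v s - w s)\<^sup>2 \<le> s * (2 * (N - ?J) / N)" using vanishing_le[OF dv that] E by simp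
    also have "\<dots> \<le> c * (2 * (N - ?J) / N)" using that JN N by (intro mult_right_mono) auto
    finally show ?thesis by (simp add: v_def)
  qed
  with JN NS show ?thesis by (intro exI[of _ N]) simp
qed

lemma uniform_limit_pospow:
  assumes u: "uniform_limit {0..c} w g sequentially" and q: "q > 1" and R: "0 \<le> R"
    and w: "\<And>n t. 0 \<le> t \<Longrightarrow> t \<le> c \<Longrightarrow> w n t \<le> R" and g: "\<And>t. 0 \<le> t \<Longrightarrow> t \<le> c \<Longrightarrow> g t \<le> R"
  shows "uniform_limit {0..c} (\<lambda>n t. h t * pospow q (w n t)) (\<lambda>t. h t * pospow q (g t)) sequentially"
proof (rule uniform_limitI)
  fix e :: real assume e: "0 < e"
  define K where "K = M * (q * R powr (q - 1))"
  have K: "0 \<le> K" using M_pos q by (simp add: K_def)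
  have d: "0 < e / (K + 1)" using e K by simp
  show "\<forall>\<^sub>F n in sequentially. \<forall>t\<in>{0..c}. dist (h t * pospow q (w n t)) (h t * pospow q (g t)) < e"
    using uniform_limitD[OF u d]
  proof eventually_elim
    case (elim n)
    show ?case
    proof
      fix t assume t: "t \<in> {0..c}"
      have "dist (h t * pospow q (w n t)) (h t * pospow q (g t))
          = h t * \<bar>pospow q (w n t) - pospow q (g t)\<bar>"
        using h_nonneg[of t] t by (simp add: dist_real_def abs_mult flip: right_diff_distrib)
      also have "\<dots> \<le> M * (q * R powr (q - 1) * \<bar>w n t - g t\<bar>)"
        using t h_le h_nonneg M_pos w g q R by (intro mult_mono pospow_lipschitz) auto
      also have "\<dots> = K * \<bar>w n t - g t\<bar>" by (simp add: K_def)
      also have "\<dots> \<le> K * (e / (K + 1))"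
        using elim t K by (intro mult_left_mono) (auto simp: dist_real_def less_imp_le)
      also have "\<dots> < (K + 1) * (e / (K + 1))"
        using d by (intro mult_strict_right_mono) auto
      also have "\<dots> = e" using K by simp
      finally show "dist (h t * pospow q (w n t)) (h t * pospow q (g t)) < e" .
    qed
  qed
qed

text \<open>A maximising sequence has a uniformly convergent subsequence with limit
  \<open>g\<close>, and energies pass to the limit. Differentiability of \<open>g\<close> is not
  known in advance, so the Euler-Lagrange equation is not derived by varying \<open>g\<close>:
  \<open>power_step\<close> says that the sequence satisfies it up to an error tending to 0, and the
  integral form survives uniform limits.\<close>

lemma maximiser:
  assumes c: "0 < c" and v: "unit_fun c v v'" and K: "0 < K" "K \<le> energy c v"
  obtains S g where "K \<le> S" "continuous_on {0..c} g" "energy c g = S"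
    "\<And>s. 0 \<le> s \<Longrightarrow> s \<le> c \<Longrightarrow> g s = green c (force g) s / S"
    "\<And>s. 0 \<le> s \<Longrightarrow> s \<le> c \<Longrightarrow> \<bar>g s\<bar> \<le> sqrt s"
proof -
  define X where "X = {energy c w |w. \<exists>w'. unit_fun c w w'}"
  define S where "S = Sup X"
  have bound: "\<bar>w t\<bar> \<le> sqrt c" if "unit_fun c w w'" "0 \<le> t" "t \<le> c" for w w' t
    using unit_fun_le[OF that] that by (smt (verit) real_sqrt_le_iff)
  have bdd: "bdd_above X"
  proof (rule bdd_aboveI)
    fix x assume "x \<in> X"
    then obtain w w' where w: "x = energy c w" "unit_fun c w w'" by (auto simp: X_def)
    then show "x \<le> M * pospow (p + 1) (sqrt c) * c"
      using bound[OF w(2)] c unfolding w(1)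
      by (intro energy_le) (auto simp: unit_fun_def intro: vanishing_cont abs_le_D1)
  qed
  have le_S: "energy c w \<le> S" if "unit_fun c w w'" for w w'
    unfolding S_def using that by (intro cSup_upper bdd) (auto simp: X_def)
  have KS: "K \<le> S" using le_S[OF v] K by simp
  have S: "0 < S" using KS K by simp
  \<comment> \<open>These multiples of \<open>S\<close> tend to \<open>S\<close> and are positive
    for every \<open>n\<close>, so all energies in the sequence are positive, as
    \<open>power_step\<close> demands.\<close>
  have "\<exists>w w'. unit_fun c w w' \<and> S * (1 - 1 / (real n + 2)) < energy c w" for n
  proof -
    have "S * (1 - 1 / (real n + 2)) < S * 1" using S by (intro mult_strict_left_mono) auto
    moreover have "X \<noteq> {}" using v by (auto simp: X_def)
    ultimately obtain x where "x \<in> X" "S * (1 - 1 / (real n + 2)) < x"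
      using less_cSup_iff[OF _ bdd] unfolding S_def by auto
    then show ?thesis by (auto simp: X_def)
  qed
  then obtain w w' where w: "\<And>n. unit_fun c (w n) (w' n)"
    "\<And>n. S * (1 - 1 / (real n + 2)) < energy c (w n)" by metis
  have wc: "continuous_on {0..c} (w n)" for n
    using w(1)[of n] vanishing_cont by (auto simp: unit_fun_def)
  obtain g k where g: "continuous_on {0..c} g" and k: "strict_mono (k :: nat \<Rightarrow> nat)"
    and lim: "\<And>e. 0 < e \<Longrightarrow> \<exists>N. \<forall>n x. n \<ge> N \<and> x \<in> {0..c} \<longrightarrow> norm (w (k n) x - g x) < e"
  proof (rule Arzela_Ascoli[of "{0..c}" w "sqrt c"])
    show "norm (w n x) \<le> sqrt c" if "x \<in> {0..c}" for n x
      using bound[OF w(1)] that by auto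
    show "\<exists>d>0. \<forall>n y. y \<in> {0..c} \<and> norm (x - y) < d \<longrightarrow> norm (w n x - w n y) < e"
      if x: "x \<in> {0..c}" and e: "0 < e" for x e
    \<comment> \<open>The choice \<open>e^2\<close> matches the Hoelder exponent 1/2.\<close>
    proof (intro exI[of _ "e\<^sup>2"] conjI allI impI)
      fix n y assume y: "y \<in> {0..c} \<and> norm (x - y) < e\<^sup>2"
      have "(w n x - w n y)\<^sup>2 \<le> \<bar>x - y\<bar>"
      proof (cases "x \<le> y")
        case True
        then show ?thesis using vanishing_holder[of c "w n" "w' n" x y] w(1)[of n] x y
          by (auto simp: unit_fun_def power2_commute)
      next
        case False
        then show ?thesis using vanishing_holder[of c "w n" "w' n" y x] w(1)[of n] x y
          by (auto simp: unit_fun_def)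
      qed
      also have "\<dots> < e\<^sup>2" using y by simp
      finally have "\<bar>w n x - w n y\<bar>\<^sup>2 < e\<^sup>2" by simp
      then show "norm (w n x - w n y) < e" using e power2_less_imp_less by fastforce
    qed (use e in auto)
  qed auto
  let ?w = "\<lambda>n. w (k n)"
  have u: "uniform_limit {0..c} ?w g sequentially"
  proof (rule uniform_limitI)
    fix e :: real assume "0 < e"
    then obtain N where "\<forall>n x. n \<ge> N \<and> x \<in> {0..c} \<longrightarrow> norm (?w n x - g x) < e"
      using lim by blast
    then show "\<forall>\<^sub>F n in sequentially. \<forall>x\<in>{0..c}. dist (?w n x) (g x) < e"
      by (intro eventually_sequentiallyI[of N]) (auto simp: dist_norm)
  qed
  have pt: "(\<lambda>n. ?w n s) \<longlonglongrightarrow> g s" if "0 \<le> s" "s \<le> c" for s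
    using tendsto_uniform_limitI[OF u] that by auto
  have g_le: "\<bar>g s\<bar> \<le> sqrt s" if s: "0 \<le> s" "s \<le> c" for s
    using tendsto_rabs[OF pt[OF s]] by (rule LIMSEQ_le_const2) (use unit_fun_le[OF w(1) s] in auto)
  have bounds: "?w n t \<le> sqrt c" "g t \<le> sqrt c" if "0 \<le> t" "t \<le> c" for n t
  proof -
    show "?w n t \<le> sqrt c" using bound[OF w(1) that] by (rule abs_le_D1)
    have "sqrt t \<le> sqrt c" using that by simp
    then show "g t \<le> sqrt c" using abs_le_D1[OF g_le[OF that]] by linarith
  qed
  have fu: "uniform_limit {0..c} (\<lambda>n. force (?w n)) (force g) sequentially"
    unfolding force_def by (rule uniform_limit_pospow[OF u p, of "sqrt c"]) (use c bounds in auto)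
  have "uniform_limit {0..c} (\<lambda>n t. h t * pospow (p + 1) (?w n t))
      (\<lambda>t. h t * pospow (p + 1) (g t)) sequentially"
    by (rule uniform_limit_pospow[OF u, of _ "sqrt c"]) (use p c bounds in auto)
  from prim_uniform_limit[OF this energy_cont[OF wc] energy_cont[OF g]]
  have "(\<lambda>n. energy c (?w n)) \<longlonglongrightarrow> energy c g"
    unfolding energy_def by (rule tendsto_uniform_limitI) (use c in auto)
  moreover have JS: "(\<lambda>n. energy c (?w n)) \<longlonglongrightarrow> S"
  proof (rule tendsto_sandwich[of "\<lambda>n. S * (1 - 1 / (real (k n) + 2))" _ _ "\<lambda>_. S"])
    have "(\<lambda>n. S * (1 - 1 / (real n + 2))) \<longlonglongrightarrow> S * (1 - 0)"
      by (intro tendsto_intros) real_asymp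
    then show "(\<lambda>n. S * (1 - 1 / (real (k n) + 2))) \<longlonglongrightarrow> S"
      using LIMSEQ_subseq_LIMSEQ[OF _ k] by (auto simp: o_def)
    show "\<forall>\<^sub>F n in sequentially. S * (1 - 1 / (real (k n) + 2)) \<le> energy c (?w n)"
      by (intro always_eventually allI less_imp_le w)
    show "\<forall>\<^sub>F n in sequentially. energy c (?w n) \<le> S"
      by (intro always_eventually allI le_S[OF w(1)])
  qed simp
  ultimately have E: "energy c g = S" by (rule LIMSEQ_unique)
  have pos: "0 < energy c (?w n)" for n
  proof -
    have "0 \<le> S * (1 - 1 / (real (k n) + 2))" using S by simp
    then show ?thesis using w(2)[of "k n"] by linarith
  qed
  have "\<forall>n. \<exists>N. energy c (?w n) \<le> N \<and> N - energy c (?w n) \<le> (S - energy c (?w n)) / (p + 1) \<and>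
      (\<forall>s\<in>{0..c}. (green c (force (?w n)) s / N - ?w n s)\<^sup>2 \<le> c * (2 * (N - energy c (?w n)) / N))"
    by (intro allI power_step[OF c w(1) pos le_S])
  then obtain N where "\<forall>n. energy c (?w n) \<le> N n \<and>
      N n - energy c (?w n) \<le> (S - energy c (?w n)) / (p + 1) \<and>
      (\<forall>s\<in>{0..c}. (green c (force (?w n)) s / N n - ?w n s)\<^sup>2 \<le> c * (2 * (N n - energy c (?w n)) / N n))"
    unfolding choice_iff by (elim exE)
  then have N: "\<And>n. energy c (?w n) \<le> N n"
    "\<And>n. N n - energy c (?w n) \<le> (S - energy c (?w n)) / (p + 1)"
    "\<And>n s. 0 \<le> s \<Longrightarrow> s \<le> c \<Longrightarrow>
      (green c (force (?w n)) s / N n - ?w n s)\<^sup>2 \<le> c * (2 * (N n - energy c (?w n)) / N n)"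
    by simp_all
  \<comment> \<open>The defect of the step is squeezed by the distance of the energy from
    \<open>S\<close>; hence the norms \<open>N n\<close> have the same limit \<open>S\<close> as the
    energies.\<close>
  have ND: "(\<lambda>n. N n - energy c (?w n)) \<longlonglongrightarrow> 0"
  proof (rule tendsto_sandwich[of "\<lambda>_. 0" _ _ "\<lambda>n. (S - energy c (?w n)) / (p + 1)"])
    have "(\<lambda>n. (S - energy c (?w n)) / (p + 1)) \<longlonglongrightarrow> (S - S) / (p + 1)"
      using p by (intro tendsto_intros JS) auto
    then show "(\<lambda>n. (S - energy c (?w n)) / (p + 1)) \<longlonglongrightarrow> 0" by simp
    show "\<forall>\<^sub>F n in sequentially. 0 \<le> N n - energy c (?w n)"
      using N(1) by (intro always_eventually allI) simp
    show "\<forall>\<^sub>F n in sequentially. N n - energy c (?w n) \<le> (S - energy c (?w n)) / (p + 1)"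
      by (intro always_eventually allI N(2))
  qed simp
  have NS: "N \<longlonglongrightarrow> S" using tendsto_add[OF ND JS] by simp
  have "g s = green c (force g) s / S" if s: "0 \<le> s" "s \<le> c" for s
  proof -
    have "(\<lambda>n. (green c (force (?w n)) s / N n - ?w n s)\<^sup>2) \<longlonglongrightarrow> 0"
    proof (rule tendsto_sandwich[of "\<lambda>_. 0" _ _ "\<lambda>n. c * (2 * (N n - energy c (?w n)) / N n)"])
      have "(\<lambda>n. c * (2 * (N n - energy c (?w n)) / N n)) \<longlonglongrightarrow> c * (2 * 0 / S)"
        using S by (intro tendsto_intros ND NS) auto
      then show "(\<lambda>n. c * (2 * (N n - energy c (?w n)) / N n)) \<longlonglongrightarrow> 0" by simp
      show "\<forall>\<^sub>F n in sequentially. (green c (force (?w n)) s / N n - ?w n s)\<^sup>2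
          \<le> c * (2 * (N n - energy c (?w n)) / N n)"
        by (intro always_eventually allI N(3) s)
    qed simp_all
    from tendsto_real_sqrt[OF this] have "(\<lambda>n. green c (force (?w n)) s / N n - ?w n s) \<longlonglongrightarrow> 0"
      by (simp add: tendsto_rabs_zero_iff)
    from tendsto_add[OF this pt[OF s]]
    have 1: "(\<lambda>n. green c (force (?w n)) s / N n) \<longlonglongrightarrow> g s" by simp
    have "uniform_limit {0..c} (\<lambda>n. prim (prim (force (?w n)))) (prim (prim (force g))) sequentially"
      by (intro prim_uniform_limit fu prim_cont force_cont wc g)
    then have "(\<lambda>n. prim (prim (force (?w n))) t) \<longlonglongrightarrow> prim (prim (force g)) t"
      if "0 \<le> t" "t \<le> c" for t by (rule tendsto_uniform_limitI) (use that in auto)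
    then have "(\<lambda>n. green c (force (?w n)) s / N n) \<longlonglongrightarrow> green c (force g) s / S"
      unfolding green_def using S NS s c by (intro tendsto_intros) auto
    with 1 show ?thesis by (rule LIMSEQ_unique)
  qed
  with KS g E g_le show thesis by (intro that)
qed

text \<open>Scaling the maximiser by \<open>k\<close> with \<open>k powr (1 - p) = S\<close> absorbs
  the multiplier \<open>S\<close>, and a large \<open>S\<close> makes \<open>k\<close> small because
  \<open>1 - p\<close> is negative. On \<open>{0..1}\<close> the rescaled function is at most
  \<open>k\<close>, so its value at 1 bounds the slope; \<open>1 \<le> c\<close> keeps that point in
  the interval.\<close>

lemma low_energy_solution:
  assumes c: "1 \<le> c" and v: "unit_fun c v v'" and m: "0 < m" "m powr (1 - p) \<le> energy c v"
  obtains a u where "0 < a" "a \<le> m + M * m powr p" "shoot c a u" "u c = 0"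
proof -
  have c0: "0 < c" using c by simp
  obtain S g where S: "m powr (1 - p) \<le> S" and gc: "continuous_on {0..c} g" and E: "energy c g = S"
    and g: "\<And>s. 0 \<le> s \<Longrightarrow> s \<le> c \<Longrightarrow> g s = green c (force g) s / S"
    and g_le: "\<And>s. 0 \<le> s \<Longrightarrow> s \<le> c \<Longrightarrow> \<bar>g s\<bar> \<le> sqrt s"
    using maximiser[OF c0 v _ m(2)] m(1) by auto
  have S0: "0 < S" using S m by (smt (verit) powr_gt_zero)
  define k where "k = S powr (1 / (1 - p))"
  have k0: "0 < k" using S0 by (simp add: k_def)
  have "k \<le> (m powr (1 - p)) powr (1 / (1 - p))"
    unfolding k_def using S m p by (intro powr_mono2') auto
  then have km: "k \<le> m" using m p by (simp add: powr_powr)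
  have "k powr (1 - p) = S" using S0 p by (simp add: k_def powr_powr)
  then have "k = S * k powr p" using k0 by (simp add: powr_diff field_simps)
  then have kS: "k / S = k powr p" using S0 by (simp add: divide_eq_eq mult.commute)
  define u where "u s = k * g s" for s
  define b where "b = prim (prim (force g)) c / c"
  define a where "a = k powr p * b"
  have fg: "continuous_on {0..c} (force g)" by (rule force_cont[OF gc])
  have "force u = (\<lambda>t. k powr p * force g t)"
    using k0 by (auto simp: force_def u_def pospow_scale)
  then have Fu: "prim (prim (force u)) s = k powr p * prim (prim (force g)) s" for s
    by (simp add: prim_mult_left_fun)
  have u: "shoot c a u"
    unfolding shoot_def
  proof (intro conjI ballI)
    show "continuous_on {0..c} u" unfolding u_def by (intro continuous_intros gc)
    fix s assume "s \<in> {0..c}"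
    then have "u s = k / S * green c (force g) s" using g[of s] by (simp add: u_def)
    then show "u s = a * s - prim (prim (force u)) s"
      unfolding kS by (simp add: Fu green_def a_def b_def algebra_simps)
  qed
  have "g c = 0" using g[of c] c by (simp add: green_def)
  then have uc: "u c = 0" by (simp add: u_def)
  have V: "0 \<le> prim (prim (force g)) s" if "0 \<le> s" "s \<le> c" for s
    using prim2_diff_bounds(1)[OF fg, of 0 s] that force_nonneg by simp
  \<comment> \<open>With \<open>b = 0\<close> the function \<open>g\<close> would be nonpositive and
    its energy would be at most 0, against \<open>energy c g = S > 0\<close>.\<close>
  have "b \<noteq> 0"
  proof
    assume "b = 0"
    then have "g s \<le> 0" if "0 \<le> s" "s \<le> c" for s
      using g[OF that] V[OF that] S0 unfolding green_def b_def[symmetric]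
      by (simp add: divide_le_0_iff)
    then have "energy c g \<le> M * pospow (p + 1) 0 * c"
      using c by (intro energy_le gc) auto
    then show False using E S0 p by (simp add: pospow_def)
  qed
  then have "0 < b" using V[of c] c by (simp add: b_def less_le)
  then have a0: "0 < a" using k0 by (simp add: a_def)
  have u_le: "u t \<le> k" if "0 \<le> t" "t \<le> 1" for t
  proof -
    have "g t \<le> sqrt t" using g_le[of t] that c by auto
    also have "\<dots> \<le> 1" using that by simp
    finally show ?thesis using k0 by (simp add: u_def)
  qed
  have "a * 1 - M * pospow p k * 1\<^sup>2 \<le> u 1"
    using c u_le by (intro shoot_ge[OF u]) auto
  then have "a \<le> k + M * k powr p" using u_le[of 1] k0 by (simp add: pospow_def)
  also have "\<dots> \<le> m + M * m powr p"
    using km k0 M_pos p by (intro add_mono mult_left_mono powr_mono2) auto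
  finally show thesis using a0 u uc by (intro that)
qed

text \<open>The competitor is a normalised parabola on an interval of length \<open>2 * t\<close>.
  On its first half it dominates \<open>k * t * s\<close>, since \<open>2 * t - s \<ge> t\<close>
  there, and this produces the integral in the growth hypothesis.\<close>

lemma test_function:
  assumes t: "0 < t"
  obtains v v' where "unit_fun (2 * t) v v'"
    "(3 / 8) powr ((p + 1) / 2) * (t powr (-(p + 1) / 2) * integral {0..t} (\<lambda>s. s powr (p + 1) * h s))
      \<le> energy (2 * t) v"
proof -
  \<comment> \<open>The Dirichlet integral of \<open>s * (2 * t - s)\<close> over
    \<open>{0..2 * t}\<close> is \<open>8 / 3 * t ^ 3\<close>; \<open>k\<close> is the reciprocal of
    its square root.\<close>
  define k where "k = sqrt (3 / (8 * t)) / t"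
  have k: "0 < k" "k\<^sup>2 * t ^ 3 = 3 / 8"
    using t by (auto simp: k_def power_divide power2_eq_square power3_eq_cube)
  define v where "v s = k * (s * (2 * t - s))" for s
  define v' where "v' s = k * (2 * t - 2 * s)" for s
  have van: "vanishing (2 * t) v v'"
    unfolding vanishing_def v_def v'_def
    by (auto intro!: continuous_intros derivative_eq_intros simp: algebra_simps)
  have "prim (\<lambda>s. (v' s)\<^sup>2) (2 * t) = k\<^sup>2 * (4 * t\<^sup>2 * (2 * t) - 4 * t * (2 * t)\<^sup>2 + 4 / 3 * (2 * t) ^ 3)"
    using t unfolding v'_def
    by (intro prim_unique[where c = "2 * t" and g = "\<lambda>s. k\<^sup>2 * (4 * t\<^sup>2 * s - 4 * t * s\<^sup>2 + 4 / 3 * s ^ 3)"])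
      (auto intro!: derivative_eq_intros simp: power2_eq_square algebra_simps)
  also have "\<dots> = 8 / 3 * (k\<^sup>2 * t ^ 3)" by (simp add: power2_eq_square power3_eq_cube algebra_simps)
  also have "\<dots> = 1" by (simp add: k)
  finally have unit: "unit_fun (2 * t) v v'" using van by (simp add: unit_fun_def)
  have vc: "continuous_on {0..2 * t} v" by (rule vanishing_cont[OF van])
  have sc: "continuous_on {0..t} (\<lambda>s. s powr (p + 1) * h s)"
    using p by (intro continuous_intros h_cont' continuous_on_powr') auto
  have "(k * t) powr (p + 1) * prim (\<lambda>s. s powr (p + 1) * h s) t
      = prim (\<lambda>s. (k * t) powr (p + 1) * (s powr (p + 1) * h s)) t"
    by (simp add: prim_mult_left)
  also have "\<dots> \<le> prim (\<lambda>s. h s * pospow (p + 1) (v s)) t"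
  proof (rule prim_mono[where c = t])
    show "continuous_on {0..t} (\<lambda>s. h s * pospow (p + 1) (v s))"
      using vc t by (intro energy_cont) (auto intro: continuous_on_subset)
    fix s assume s: "0 \<le> s" "s \<le> t"
    have "k * t * s \<le> v s" using s k by (auto simp: v_def algebra_simps intro!: mult_left_mono)
    then have "pospow (p + 1) (k * t * s) \<le> pospow (p + 1) (v s)" using p by (intro pospow_mono) auto
    then have "(k * t) powr (p + 1) * s powr (p + 1) \<le> pospow (p + 1) (v s)"
      using k t s by (simp add: pospow_def powr_mult)
    then show "(k * t) powr (p + 1) * (s powr (p + 1) * h s) \<le> h s * pospow (p + 1) (v s)"
      using h_nonneg[OF s(1)] by (metis mult.assoc mult.commute mult_left_mono)
  qed (use sc in \<open>auto intro!: continuous_intros\<close>)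
  also have "\<dots> \<le> energy (2 * t) v"
    unfolding energy_def using t h_nonneg
    by (intro prim_incr[OF energy_cont[OF vc]]) auto
  also have "(k * t) powr (p + 1) = (3 / 8) powr ((p + 1) / 2) * t powr (-(p + 1) / 2)"
  proof -
    have kt: "k * t = (3 / 8 / t) powr (1 / 2)" using t by (simp add: k_def powr_half_sqrt)
    have "(k * t) powr (p + 1) = (3 / 8 / t) powr ((p + 1) / 2)"
      unfolding kt powr_powr by simp
    also have "\<dots> = (3 / 8) powr ((p + 1) / 2) / t powr ((p + 1) / 2)"
      by (rule powr_divide)
    also have "\<dots> = (3 / 8) powr ((p + 1) / 2) * t powr (- ((p + 1) / 2))"
      by (simp only: powr_minus divide_inverse)
    also have "- ((p + 1) / 2) = -(p + 1) / 2" by (rule minus_divide_left)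
    finally show ?thesis .
  qed
  finally show thesis using unit by (intro that) (auto simp: prim_def mult.assoc)
qed

section \<open>Counting zeros of the shooting map\<close>

lemma shoot_zero_between:
  assumes c: "0 < c" and ab: "0 \<le> a" "a < b"
    and v: "shoot c a v" and w: "shoot c b w" and sgn: "v c * w c < 0"
  shows "\<exists>x u. a < x \<and> x < b \<and> shoot c x u \<and> u c = 0"
proof -
  \<comment> \<open>An arbitrary choice of solution for each slope; by uniqueness its value at
    \<open>c\<close> agrees with that of \<open>v\<close> and \<open>w\<close> at the end slopes,
    and the intermediate value theorem applies to \<open>W x c\<close>.\<close>
  define W where "W x = (SOME u. shoot c x u)" for x
  have W: "shoot c x (W x)" if "0 \<le> x" for x
    unfolding W_def using shoot_exists[OF c that] by (rule someI_ex)
  have b0: "0 \<le> b" using ab by simp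
  obtain C where "\<forall>x\<in>{0..b}. \<forall>y\<in>{0..b}. \<forall>u z. shoot c x u \<longrightarrow> shoot c y z \<longrightarrow>
      (\<forall>s\<in>{0..c}. \<bar>u s - z s\<bar> \<le> C * \<bar>x - y\<bar>)"
    using shoot_lipschitz[OF c b0] by blast
  then have C: "\<bar>u c - z c\<bar> \<le> C * \<bar>x - y\<bar>"
    if "x \<in> {0..b}" "y \<in> {0..b}" "shoot c x u" "shoot c y z" for x y u z
    using that c by auto
  have vW: "v c = W a c" and wW: "w c = W b c"
    using C[OF _ _ v W[of a]] C[OF _ _ w W[of b]] ab by auto
  have "continuous_on {a..b} (\<lambda>x. W x c)"
  proof (rule lipschitz_on_continuous_on[of "max 0 C"], rule lipschitz_onI)
    fix x y assume "x \<in> {a..b}" "y \<in> {a..b}"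
    then have "\<bar>W x c - W y c\<bar> \<le> C * \<bar>x - y\<bar>" using ab by (intro C W) auto
    also have "\<dots> \<le> max 0 C * \<bar>x - y\<bar>" by (intro mult_right_mono) auto
    finally show "dist (W x c) (W y c) \<le> max 0 C * dist x y" by (simp add: dist_real_def)
  qed auto
  then have "\<exists>x. a \<le> x \<and> x \<le> b \<and> W x c = 0"
    using IVT'[of "\<lambda>x. W x c" a 0 b] IVT2'[of "\<lambda>x. W x c" b 0 a] ab sgn
    unfolding vW wW by (auto simp: mult_less_0_iff less_imp_le)
  then obtain x where x: "a \<le> x" "x \<le> b" "W x c = 0" by blast
  moreover have "x \<noteq> a" "x \<noteq> b" using x sgn unfolding vW wW by auto
  ultimately show ?thesis using W[of x] ab by (intro exI[of _ x] exI[of _ "W x"]) auto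
qed

text \<open>At \<open>c\<close> the signs are plus, minus, plus, minus along the slopes
  \<open>x < a1 < a0 < b\<close>, where \<open>x\<close> is small and \<open>b\<close> is large. The
  three sign changes give zeros at three different slopes.\<close>

lemma three_solutions:
  assumes c1: "0 < c1" "c1 < c" and a: "0 < a1" "a1 < a0"
    and u: "shoot c1 a1 u" "u c1 = 0" and w: "shoot c a0 w" "0 < w c"
  shows "\<exists>w1 w2 w3.
           dirichlet_pos_sol h p c w1 \<and> dirichlet_pos_sol h p c w2 \<and> dirichlet_pos_sol h p c w3
           \<and> differ_on {0..c} w1 w2 \<and> differ_on {0..c} w1 w3 \<and> differ_on {0..c} w2 w3"
proof -
  have c: "0 < c" using c1 by simp
  obtain v where v: "shoot c a1 v" using shoot_exists[OF c, of a1] a by auto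
  \<comment> \<open>Uniqueness on \<open>{0..c1}\<close>: the bound is a multiple of
    \<open>a1 - a1\<close>, so the longer solution \<open>v\<close> shares the zero of
    \<open>u\<close> and is negative at \<open>c\<close>.\<close>
  obtain C where "\<bar>v c1 - u c1\<bar> \<le> C * \<bar>a1 - a1\<bar>"
    using shoot_lipschitz[OF c1(1), of a1] a u shoot_restrict[OF v, of c1] c1 by fastforce
  then have "v c1 = 0" using u by simp
  then have vc: "v c < 0" using shoot_neg_after_zero[OF v a(1) c1] by simp
  obtain e where e: "0 < e" "\<And>a s w. 0 < a \<Longrightarrow> 0 < s \<Longrightarrow> s \<le> c \<Longrightarrow> a * s \<le> e \<Longrightarrow> shoot c a w \<Longrightarrow> 0 < w s"
    using shoot_small[OF c] by blast
  define x where "x = min (a1 / 2) (e / c)"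
  have x: "0 < x" "x < a1" "x * c \<le> e"
    using a e c by (auto simp: x_def min_def field_simps)
  obtain y where y: "shoot c x y" using shoot_exists[OF c, of x] x by auto
  have yc: "0 < y c" using e(2)[OF x(1) c _ x(3) y] by simp
  obtain A where A: "\<And>a w. A \<le> a \<Longrightarrow> shoot c a w \<Longrightarrow> w c < 0" using shoot_large[OF c] by blast
  define b where "b = max A (a0 + 1)"
  have b: "a0 < b" by (simp add: b_def)
  obtain z where z: "shoot c b z" using shoot_exists[OF c, of b] a b by auto
  have zc: "z c < 0" using A[OF _ z] by (simp add: b_def)
  obtain x1 w1 where 1: "x < x1" "x1 < a1" "shoot c x1 w1" "w1 c = 0"
    using shoot_zero_between[OF c _ x(2) y v] x yc vc by (auto simp: mult_less_0_iff)
  obtain x2 w2 where 2: "a1 < x2" "x2 < a0" "shoot c x2 w2" "w2 c = 0"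
    using shoot_zero_between[OF c _ a(2) v w(1)] a w vc by (auto simp: mult_less_0_iff)
  obtain x3 w3 where 3: "a0 < x3" "shoot c x3 w3" "w3 c = 0"
    using shoot_zero_between[OF c _ b w(1) z] a w zc by (auto simp: mult_less_0_iff)
  have d: "differ_on {0..c} f g" if "shoot c r f" "shoot c s g" "r < s" for f g r s
    unfolding differ_on_def using shoot_slope_unique[OF that(1,2) c] that(3) by (metis less_irrefl)
  have "dirichlet_pos_sol h p c w1" using x(1) 1 c by (intro shoot_dirichlet[OF 1(3)]) auto
  moreover have "dirichlet_pos_sol h p c w2" using a 2 c by (intro shoot_dirichlet[OF 2(3)]) auto
  moreover have "dirichlet_pos_sol h p c w3" using a 3 c by (intro shoot_dirichlet[OF 3(2)]) auto
  moreover have "differ_on {0..c} w1 w2" using 1 2 by (intro d[OF 1(3) 2(3)]) auto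
  moreover have "differ_on {0..c} w1 w3" using 1 2 3 by (intro d[OF 1(3) 3(2)]) auto
  moreover have "differ_on {0..c} w2 w3" using 2 3 by (intro d[OF 2(3) 3(2)]) auto
  ultimately show ?thesis by blast
qed

end

theorem theorem2p2:
  fixes p :: real and h w0 :: "real \<Rightarrow> real"
  assumes "p > 1"
    and "continuous_on {0..} h"
    and "\<And>s. s > 0 \<Longrightarrow> h s > 0"
    and "\<exists>M. \<forall>s\<ge>0. \<bar>h s\<bar> \<le> M"
    and "filterlim (\<lambda>t. t powr (-(p + 1) / 2) * integral {0..t} (\<lambda>s. s powr (p + 1) * h s))
           at_top at_top"
    and "continuous_on {0..} w0" and "ode_sol_on h p {0<..} w0"
    and "w0 0 = 0" and "\<And>s. s > 0 \<Longrightarrow> w0 s > 0"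
  shows "\<forall>\<^sub>F c in at_top. \<exists>w1 w2 w3.
           dirichlet_pos_sol h p c w1 \<and> dirichlet_pos_sol h p c w2 \<and> dirichlet_pos_sol h p c w3
           \<and> differ_on {0..c} w1 w2 \<and> differ_on {0..c} w1 w3 \<and> differ_on {0..c} w2 w3"
proof -
  obtain M where M: "\<And>s. 0 \<le> s \<Longrightarrow> \<bar>h s\<bar> \<le> M" using assms(4) by blast
  interpret emden_fowler p M h
    using assms(1-3) M by unfold_locales (auto dest: abs_le_D1)
  obtain a0 where a0: "0 < a0" "\<And>c. shoot c a0 w0"
    using ode_sol_shoot[OF assms(6-9)] by blast
  obtain e where e: "0 < e" "\<And>x. 0 < x \<Longrightarrow> x \<le> e \<Longrightarrow> M * x powr p < x"
    using small_scale[OF M_pos] by blast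
  \<comment> \<open>With \<open>m \<le> e\<close> the term \<open>M * m powr p\<close> is below
    \<open>m\<close>, so the slope bound of \<open>low_energy_solution\<close> is below
    \<open>2 * m \<le> a0\<close>.\<close>
  define m where "m = min e (a0 / 2)"
  have m: "0 < m" "m + M * m powr p < a0" using e(1) e(2)[of m] a0(1) by (auto simp: m_def)
  let ?q = "(3 / 8 :: real) powr ((p + 1) / 2)"
  let ?I = "\<lambda>t. t powr (-(p + 1) / 2) * integral {0..t} (\<lambda>s. s powr (p + 1) * h s)"
  \<comment> \<open>One \<open>t\<close> is enough: it fixes a solution of slope
    \<open>a1 < a0\<close> with a zero at \<open>2 * t\<close>, and every \<open>c > 2 * t\<close>
    is then covered by \<open>three_solutions\<close>.\<close>
  have "\<forall>\<^sub>F t in at_top. m powr (1 - p) / ?q \<le> ?I t \<and> 1 \<le> t"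
    using assms(5) by (intro eventually_conj eventually_ge_at_top) (simp add: filterlim_at_top)
  then obtain t where t: "m powr (1 - p) / ?q \<le> ?I t" "1 \<le> t"
    using eventually_happens'[OF trivial_limit_at_top_linorder] by blast
  obtain v v' where v: "unit_fun (2 * t) v v'" "?q * ?I t \<le> energy (2 * t) v"
    using test_function[of t] t(2) by auto
  have "m powr (1 - p) \<le> ?q * ?I t" using t(1) by (simp add: divide_le_eq mult.commute)
  then have E: "m powr (1 - p) \<le> energy (2 * t) v" using v(2) by linarith
  have "1 \<le> 2 * t" using t(2) by simp
  from low_energy_solution[OF this v(1) m(1) E] obtain a1 u where
    a1: "0 < a1" "a1 \<le> m + M * m powr p" "shoot (2 * t) a1 u" "u (2 * t) = 0"
    by metis
  show ?thesis
    using eventually_gt_at_top[of "2 * t"]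
  proof eventually_elim
    case (elim c)
    have "0 < 2 * t" "a1 < a0" "0 < w0 c" using a1(2) m(2) t(2) elim assms(9)[of c] by simp_all
    from three_solutions[OF this(1) elim a1(1) this(2) a1(3,4) a0(2) this(3)] show ?case .
  qed
qed

end
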